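(* For an equipped finite group $(G,O)$ we have $a_{(G,O)}=b_{(G,O)}$.
   Context: An equipped finite group $(G,O)$ is a finite group $G$ together with a subset $O\subset G$ that is a union of conjugacy classes of $G$ and generates $G$. Ambiguity index: let $\widetilde G$ be the group generated by the letters $y_g$, $g\in O$, subject to the relations $y_{g_1}y_{g_2}=y_{g_2}y_{g_2^{-1}g_1g_2}=y_{g_1g_2g_1^{-1}}y_{g_1}$ for all $g_1,g_2\in O$, and let $\beta:\widetilde G\to G$ be the homomorphism with $\beta(y_g)=g$. The commutator subgroup $[\widetilde G,\widetilde G]$ is known to be finite, and $a_{(G,O)}$ is the order of $\ker\beta\cap[\widetilde G,\widetilde G]$. Let $\mathbb F_O$ be the free group on $\{x_g\mid g\in O\}$, $h_O:\mathbb F_O\to G$ the epimorphism $x_g\mapsto g$, and $R_O=\ker h_O$. By Hopf's formula, $H_2(G,\mathbb Z)\simeq (R_O\cap[\mathbb F_O,\mathbb F_O])/[\mathbb F_O,R_O]$. Let $K_{(G,O)}$ be the subgroup of $H_2(G,\mathbb Z)$ generated by the classes of the elements of $R_O$ of the form $[w,x_g]$ with $g\in O$, $w\in\mathbb F_O$. With the identification $H^2(G,\mathbb Q/\mathbb Z)=\mathrm{Hom}(H_2(G,\mathbb Z),\mathbb Q/\mathbb Z)$ (trivial action), define $$B_{(G,O)}=\{\varphi\in \mathrm{Hom}(H_2(G,\mathbb Z),\mathbb Q/\mathbb Z)\mid \varphi(w)=0\text{ for all }w\in K_{(G,O)}\}.$$ Equivalently (as the paper remarks), $B_{(G,O)}=\ker\bigl[H^2(G,\mathbb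 Q/\mathbb Z)\to\prod_A H^2(A,\mathbb Q/\mathbb Z)\bigr]$, where $A$ runs over all abelian subgroups of $G$ generated by two elements $g\in O$ and $h\in G$. $b_{(G,O)}$ is the order of $B_{(G,O)}$. *)

theory Defs
  imports "HOL-Algebra.Algebra"
begin

section \<open>Free groups\<close>

text \<open>The letter \<open>(False, s)\<close> stands for the generator \<open>s\<close>, the letter \<open>(True, s)\<close> for its
  formal inverse. The elements of the free group are the freely reduced words.\<close>

type_synonym 'a word = "(bool \<times> 'a) list"

definition inv_letter :: "bool \<times> 'a \<Rightarrow> bool \<times> 'a"
  where "inv_letter l = (\<not> fst l, snd l)"

definition reduced :: "'a word \<Rightarrow> bool"
  where "reduced = successively (\<lambda>l k. k \<noteq> inv_letter l)"

fun cancel_Cons :: "bool \<times> 'a \<Rightarrow> 'a word \<Rightarrow> 'a word"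
  where
    "cancel_Cons l [] = [l]"
  | "cancel_Cons l (k # w) = (if k = inv_letter l then w else l # k # w)"

definition reduce :: "'a word \<Rightarrow> 'a word"
  where "reduce w = foldr cancel_Cons w []"

definition free_group :: "'a set \<Rightarrow> 'a word monoid"
  where "free_group S =
    \<lparr>carrier = {w. w \<in> lists (UNIV \<times> S) \<and> reduced w},
     monoid.mult = (\<lambda>u v. reduce (u @ v)),
     one = []\<rparr>"

definition free_gen :: "'a \<Rightarrow> 'a word"
  where "free_gen s = [(False, s)]"

text \<open>The value of a word whose letters are elements of a group \<open>G\<close>.\<close>

definition word_val :: "('a, 'b) monoid_scheme \<Rightarrow> 'a word \<Rightarrow> 'a"
  where "word_val G w =
    foldr (\<lambda>l a. (if fst l then inv\<^bsub>G\<^esub> (snd l) else snd l) \<otimes>\<^bsub>G\<^esub> a) w \<one>\<^bsub>G\<^esub>"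


section \<open>Presentations and commutators\<close>

definition normal_closure :: "('a, 'b) monoid_scheme \<Rightarrow> 'a set \<Rightarrow> 'a set"
  where "normal_closure G R = \<Inter> {N. N \<lhd> G \<and> R \<subseteq> N}"

text \<open>A relation \<open>u = v\<close> is given as the pair \<open>(u, v)\<close> of elements of the free group.\<close>

definition presented_group :: "'a set \<Rightarrow> ('a word \<times> 'a word) set \<Rightarrow> 'a word set monoid"
  where "presented_group S E =
    free_group S Mod normal_closure (free_group S)
      {u \<otimes>\<^bsub>free_group S\<^esub> inv\<^bsub>free_group S\<^esub> v | u v. (u, v) \<in> E}"

definition commutator :: "('a, 'b) monoid_scheme \<Rightarrow> 'a \<Rightarrow> 'a \<Rightarrow> 'a"
  where "commutator G a b = a \<otimes>\<^bsub>G\<^esub> b \<otimes>\<^bsub>G\<^esub> inv\<^bsub>G\<^esub> a \<otimes>\<^bsub>G\<^esub> inv\<^bsub>G\<^esub> b"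

definition mixed_commutator_subgroup :: "('a, 'b) monoid_scheme \<Rightarrow> 'a set \<Rightarrow> 'a set \<Rightarrow> 'a set"
  where "mixed_commutator_subgroup G A B = generate G {commutator G a b | a b. a \<in> A \<and> b \<in> B}"


section \<open>Equipped finite groups and the ambiguity index\<close>

definition conj_class :: "('a, 'b) monoid_scheme \<Rightarrow> 'a \<Rightarrow> 'a set"
  where "conj_class G g = {h \<otimes>\<^bsub>G\<^esub> g \<otimes>\<^bsub>G\<^esub> inv\<^bsub>G\<^esub> h | h. h \<in> carrier G}"

locale equipped_finite_group = group G for G (structure) +
  fixes \<O> :: "'a set"
  assumes finite_carrier: "finite (carrier G)"
    and union_of_conj_classes: "\<exists>T \<subseteq> carrier G. \<O> = (\<Union>g\<in>T. conj_class G g)"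
    and generates: "generate G \<O> = carrier G"

definition cover_relations :: "('a, 'b) monoid_scheme \<Rightarrow> 'a set \<Rightarrow> ('a word \<times> 'a word) set"
  where "cover_relations G \<O> =
    {(free_gen g \<otimes>\<^bsub>free_group \<O>\<^esub> free_gen h,
      free_gen h \<otimes>\<^bsub>free_group \<O>\<^esub> free_gen (inv\<^bsub>G\<^esub> h \<otimes>\<^bsub>G\<^esub> g \<otimes>\<^bsub>G\<^esub> h)) | g h. g \<in> \<O> \<and> h \<in> \<O>} \<union>
    {(free_gen g \<otimes>\<^bsub>free_group \<O>\<^esub> free_gen h,
      free_gen (g \<otimes>\<^bsub>G\<^esub> h \<otimes>\<^bsub>G\<^esub> inv\<^bsub>G\<^esub> g) \<otimes>\<^bsub>free_group \<O>\<^esub> free_gen g) | g h. g \<in> \<O> \<and> h \<in> \<O>}"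

definition cover_group :: "('a, 'b) monoid_scheme \<Rightarrow> 'a set \<Rightarrow> 'a word set monoid"
  where "cover_group G \<O> = presented_group \<O> (cover_relations G \<O>)"

definition cover_gen :: "('a, 'b) monoid_scheme \<Rightarrow> 'a set \<Rightarrow> 'a \<Rightarrow> 'a word set"
  where "cover_gen G \<O> g =
    normal_closure (free_group \<O>)
      {u \<otimes>\<^bsub>free_group \<O>\<^esub> inv\<^bsub>free_group \<O>\<^esub> v | u v. (u, v) \<in> cover_relations G \<O>}
    #>\<^bsub>free_group \<O>\<^esub> free_gen g"

text \<open>The value of a word is constant on the cosets forming \<open>cover_group G \<O>\<close>; see
  \<open>cover_hom_hom\<close> and \<open>cover_hom_gen\<close> below.\<close>

definition cover_hom :: "('a, 'b) monoid_scheme \<Rightarrow> 'a word set \<Rightarrow> 'a"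
  where "cover_hom G C = the_elem (word_val G ` C)"

definition ambiguity_index :: "('a, 'b) monoid_scheme \<Rightarrow> 'a set \<Rightarrow> nat"
  where "ambiguity_index G \<O> =
    card (kernel (cover_group G \<O>) G (cover_hom G) \<inter>
          derived (cover_group G \<O>) (carrier (cover_group G \<O>)))"


section \<open>The second homology group by Hopf's formula\<close>

text \<open>Write \<open>F\<close> for the free group on \<open>\<O>\<close> and \<open>R\<close> for the kernel of the map \<open>F \<rightarrow> G\<close>. The group
  \<open>H\<^sub>2(G, \<int>)\<close> is realised as \<open>(R \<inter> [F, F]) / [F, R]\<close>, and \<open>H\<^sup>2(G, \<rat>/\<int>)\<close> as \<open>Hom(H\<^sub>2(G, \<int>), \<rat>/\<int>)\<close>
  for the trivial action on \<open>\<rat>/\<int>\<close>.\<close>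

definition relator_subgroup :: "('a, 'b) monoid_scheme \<Rightarrow> 'a set \<Rightarrow> 'a word set"
  where "relator_subgroup G \<O> = kernel (free_group \<O>) G (word_val G)"

definition hopf_denominator :: "('a, 'b) monoid_scheme \<Rightarrow> 'a set \<Rightarrow> 'a word set"
  where "hopf_denominator G \<O> =
    mixed_commutator_subgroup (free_group \<O>) (carrier (free_group \<O>)) (relator_subgroup G \<O>)"

definition hopf_H2 :: "('a, 'b) monoid_scheme \<Rightarrow> 'a set \<Rightarrow> 'a word set monoid"
  where "hopf_H2 G \<O> =
    free_group \<O>
      \<lparr>carrier := relator_subgroup G \<O> \<inter> derived (free_group \<O>) (carrier (free_group \<O>))\<rparr>
    Mod hopf_denominator G \<O>"

definition K_subgroup :: "('a, 'b) monoid_scheme \<Rightarrow> 'a set \<Rightarrow> 'a word set set"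
  where "K_subgroup G \<O> =
    generate (hopf_H2 G \<O>)
      {hopf_denominator G \<O> #>\<^bsub>free_group \<O>\<^esub> commutator (free_group \<O>) w (free_gen g) | w g.
         w \<in> carrier (free_group \<O>) \<and> g \<in> \<O> \<and>
         commutator (free_group \<O>) w (free_gen g) \<in> relator_subgroup G \<O>}"

definition rat_group :: "rat monoid"
  where "rat_group = \<lparr>carrier = UNIV, monoid.mult = (+), one = 0\<rparr>"

definition Q_mod_Z :: "rat set monoid"
  where "Q_mod_Z = rat_group Mod \<int>"

text \<open>A member of \<open>hom\<close> may take arbitrary values outside the carrier, so that homomorphisms
  have to be made extensional before they can be counted.\<close>

definition B_group :: "('a, 'b) monoid_scheme \<Rightarrow> 'a set \<Rightarrow> ('a word set \<Rightarrow> rat set) set"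
  where "B_group G \<O> =
    {\<phi> \<in> hom (hopf_H2 G \<O>) Q_mod_Z \<inter> extensional (carrier (hopf_H2 G \<O>)).
       \<forall>c \<in> K_subgroup G \<O>. \<phi> c = \<one>\<^bsub>Q_mod_Z\<^esub>}"

definition b_index :: "('a, 'b) monoid_scheme \<Rightarrow> 'a set \<Rightarrow> nat"
  where "b_index G \<O> = card (B_group G \<O>)"


section \<open>Well-definedness\<close>

lemma inv_letter_inv_letter [simp]: "inv_letter (inv_letter l) = l"
  by (simp add: inv_letter_def)

lemma inv_letter_in_iff: "inv_letter l \<in> UNIV \<times> S \<longleftrightarrow> l \<in> UNIV \<times> S"
  by (cases l) (simp add: inv_letter_def)

lemma reduced_Nil [simp]: "reduced []"
  and reduced_single [simp]: "reduced [l]"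
  and reduced_Cons_Cons [simp]: "reduced (l # k # w) \<longleftrightarrow> k \<noteq> inv_letter l \<and> reduced (k # w)"
  by (simp_all add: reduced_def)

lemma reduced_ConsD: "reduced (l # w) \<Longrightarrow> reduced w"
  by (cases w) auto

lemma reduced_cancel_Cons: "reduced w \<Longrightarrow> reduced (cancel_Cons l w)"
  by (cases w) (auto dest: reduced_ConsD)

lemma cancel_Cons_inverse: "reduced w \<Longrightarrow> cancel_Cons l (cancel_Cons (inv_letter l) w) = w"
proof (cases w)
  case (Cons k v)
  assume "reduced w"
  then show ?thesis using Cons by (cases v) auto
qed simp

lemma reduced_foldr: "reduced v \<Longrightarrow> reduced (foldr cancel_Cons u v)"
  by (induction u) (auto intro: reduced_cancel_Cons)

lemma reduced_reduce: "reduced (reduce w)"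
  by (simp add: reduce_def reduced_foldr)

lemma reduce_reduced: "reduced w \<Longrightarrow> reduce w = w"
proof (induction w)
  case (Cons l w)
  then have "reduce w = w" using reduced_ConsD by blast
  with Cons show ?case by (cases w) (auto simp: reduce_def)
qed (simp add: reduce_def)

lemma foldr_cancel_Cons_cancel:
  assumes "reduced v"
  shows "foldr cancel_Cons (cancel_Cons l w) v = cancel_Cons l (foldr cancel_Cons w v)"
proof (cases w)
  case (Cons k u)
  then show ?thesis
    using cancel_Cons_inverse[of "foldr cancel_Cons u v" l] reduced_foldr[OF assms] by auto
qed simp

lemma foldr_reduce:
  assumes "reduced v"
  shows "foldr cancel_Cons (reduce u) v = foldr cancel_Cons u v"
  by (induction u) (simp_all add: reduce_def foldr_cancel_Cons_cancel[OF assms])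

lemma reduce_append: "reduce (u @ v) = foldr cancel_Cons u (reduce v)"
  by (simp add: reduce_def)

lemma reduce_in_lists: "w \<in> lists (UNIV \<times> S) \<Longrightarrow> reduce w \<in> lists (UNIV \<times> S)"
proof (induction w)
  case (Cons l w)
  have "cancel_Cons l u \<in> lists (UNIV \<times> S)" if "u \<in> lists (UNIV \<times> S)" for u :: "'a word"
    using that Cons.prems by (cases u) auto
  with Cons show ?case by (simp add: reduce_def)
qed (simp add: reduce_def)

lemma inverse_word: "reduce (map inv_letter (rev w) @ w) = []"
proof (induction w)
  case (Cons l w)
  have "reduce (map inv_letter (rev (l # w)) @ (l # w))
      = foldr cancel_Cons (map inv_letter (rev w)) (cancel_Cons (inv_letter l) (cancel_Cons l (reduce w)))"
    by (simp add: reduce_def)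
  also have "cancel_Cons (inv_letter l) (cancel_Cons l (reduce w)) = reduce w"
    using cancel_Cons_inverse[OF reduced_reduce, of "inv_letter l" w] by simp
  finally show ?case using Cons by (simp add: reduce_append)
qed (simp add: reduce_def)

lemma image_eq_singleton: "(\<And>x. x \<in> A \<Longrightarrow> f x = c) \<Longrightarrow> a \<in> A \<Longrightarrow> f ` A = {c}"
  by auto

lemma carrier_free_group: "carrier (free_group S) = {w \<in> lists (UNIV \<times> S). reduced w}"
  and mult_free_group: "u \<otimes>\<^bsub>free_group S\<^esub> v = reduce (u @ v)"
  and one_free_group: "\<one>\<^bsub>free_group S\<^esub> = []"
  by (simp_all add: free_group_def)

lemma group_free_group: "group (free_group S)"
proof (rule groupI)
  fix u v assume "u \<in> carrier (free_group S)" "v \<in> carrier (free_group S)"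
  then have "u @ v \<in> lists (UNIV \<times> S)" by (auto simp: carrier_free_group)
  then show "u \<otimes>\<^bsub>free_group S\<^esub> v \<in> carrier (free_group S)"
    using reduce_in_lists[of "u @ v" S] by (simp add: carrier_free_group mult_free_group reduced_reduce)
next
  show "\<one>\<^bsub>free_group S\<^esub> \<in> carrier (free_group S)"
    by (simp add: carrier_free_group one_free_group)
next
  fix u v w
  show "u \<otimes>\<^bsub>free_group S\<^esub> v \<otimes>\<^bsub>free_group S\<^esub> w = u \<otimes>\<^bsub>free_group S\<^esub> (v \<otimes>\<^bsub>free_group S\<^esub> w)"
  proof -
    have "reduce (reduce (u @ v) @ w) = foldr cancel_Cons (u @ v) (reduce w)"
      by (simp only: reduce_append[of "reduce (u @ v)"] foldr_reduce[OF reduced_reduce])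
    moreover have "reduce (u @ reduce (v @ w)) = foldr cancel_Cons u (reduce (v @ w))"
      by (simp only: reduce_append[of u] reduce_reduced[OF reduced_reduce])
    ultimately show ?thesis by (simp add: mult_free_group reduce_append[of v])
  qed
next
  fix u assume "u \<in> carrier (free_group S)"
  then show "\<one>\<^bsub>free_group S\<^esub> \<otimes>\<^bsub>free_group S\<^esub> u = u"
    by (simp add: carrier_free_group mult_free_group one_free_group reduce_reduced)
next
  fix u assume u: "u \<in> carrier (free_group S)"
  let ?v = "reduce (map inv_letter (rev u))"
  have "map inv_letter (rev u) \<in> lists (UNIV \<times> S)"
    using u by (auto simp: carrier_free_group in_lists_conv_set inv_letter_def)
  then have "?v \<in> carrier (free_group S)"
    using reduce_in_lists[of _ S] by (simp add: carrier_free_group reduced_reduce)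
  moreover have "?v \<otimes>\<^bsub>free_group S\<^esub> u = \<one>\<^bsub>free_group S\<^esub>"
    using inverse_word[of u]
    by (simp add: mult_free_group one_free_group reduce_append foldr_reduce reduced_reduce)
  ultimately show "\<exists>v\<in>carrier (free_group S). v \<otimes>\<^bsub>free_group S\<^esub> u = \<one>\<^bsub>free_group S\<^esub>"
    by blast
qed

lemma free_gen_in_carrier: "s \<in> S \<Longrightarrow> free_gen s \<in> carrier (free_group S)"
  by (simp add: carrier_free_group free_gen_def)

context group
begin

lemma word_val_closed: "w \<in> lists (UNIV \<times> carrier G) \<Longrightarrow> word_val G w \<in> carrier G"
  by (induction w) (auto simp: word_val_def)

lemma word_val_cancel_Cons:
  assumes "l \<in> UNIV \<times> carrier G" "w \<in> lists (UNIV \<times> carrier G)"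
  shows "word_val G (cancel_Cons l w) = word_val G (l # w)"
proof (cases w)
  case (Cons k v)
  have v: "word_val G v \<in> carrier G" using assms Cons word_val_closed by auto
  show ?thesis
  proof (cases "k = inv_letter l")
    case True
    have "word_val G (l # w) = word_val G v"
      using assms(1) v Cons True
      by (cases l) (auto simp: word_val_def inv_letter_def m_assoc[symmetric])
    then show ?thesis using Cons True by simp
  qed (simp add: Cons)
qed (simp)

lemma word_val_reduce:
  "w \<in> lists (UNIV \<times> carrier G) \<Longrightarrow> word_val G (reduce w) = word_val G w"
proof (induction w)
  case (Cons l w)
  have "word_val G (reduce (l # w)) = word_val G (cancel_Cons l (reduce w))"
    by (simp add: reduce_def)
  also have "\<dots> = word_val G (l # reduce w)"
    using Cons reduce_in_lists by (intro word_val_cancel_Cons) auto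
  finally show ?case using Cons by (simp add: word_val_def)
qed (simp add: reduce_def)

lemma word_val_append:
  assumes "u \<in> lists (UNIV \<times> carrier G)" "v \<in> lists (UNIV \<times> carrier G)"
  shows "word_val G (u @ v) = word_val G u \<otimes> word_val G v"
  using assms(1)
proof (induction u)
  case Nil
  then show ?case using word_val_closed[OF assms(2)] by (simp add: word_val_def)
next
  case (Cons l u)
  have "word_val G u \<in> carrier G" "word_val G v \<in> carrier G"
    using Cons assms(2) word_val_closed by auto
  with Cons show ?case by (auto simp: word_val_def m_assoc)
qed

lemma word_val_hom:
  assumes "S \<subseteq> carrier G"
  shows "word_val G \<in> hom (free_group S) G"
proof (rule homI)
  have sub: "carrier (free_group S) \<subseteq> lists (UNIV \<times> carrier G)"
    using assms by (fastforce simp: carrier_free_group in_lists_conv_set)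
  show "word_val G u \<in> carrier G" if "u \<in> carrier (free_group S)" for u
    using that sub word_val_closed by blast
  show "word_val G (u \<otimes>\<^bsub>free_group S\<^esub> v) = word_val G u \<otimes> word_val G v"
    if "u \<in> carrier (free_group S)" "v \<in> carrier (free_group S)" for u v
  proof -
    have "u \<in> lists (UNIV \<times> carrier G)" "v \<in> lists (UNIV \<times> carrier G)"
      using that sub by blast+
    then show ?thesis
      using word_val_reduce[of "u @ v"] word_val_append[of u v] by (simp add: mult_free_group)
  qed
qed

lemma word_val_free_gen: "g \<in> carrier G \<Longrightarrow> word_val G (free_gen g) = g"
  by (simp add: word_val_def free_gen_def)

lemma normal_carrier: "carrier G \<lhd> G"
  by (simp add: normal_inv_iff subgroup_self)

lemma normal_closure_normal:
  assumes "R \<subseteq> carrier G"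
  shows "normal_closure G R \<lhd> G"
proof -
  let ?A = "{N. N \<lhd> G \<and> R \<subseteq> N}"
  have "?A \<noteq> {}" using normal_carrier assms by blast
  then have "subgroup (\<Inter>?A) G"
    by (intro subgroups_Inter) (auto simp: normal_imp_subgroup)
  moreover have "\<forall>x\<in>carrier G. \<forall>h\<in>\<Inter>?A. x \<otimes> h \<otimes> inv x \<in> \<Inter>?A"
    by (auto simp: normal_inv_iff)
  ultimately show ?thesis by (simp add: normal_closure_def normal_inv_iff)
qed

lemma normal_closure_subset: "R \<subseteq> N \<Longrightarrow> N \<lhd> G \<Longrightarrow> normal_closure G R \<subseteq> N"
  by (auto simp: normal_closure_def)

end

context equipped_finite_group
begin

lemma conj_class_subset: "g \<in> carrier G \<Longrightarrow> conj_class G g \<subseteq> carrier G"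
  by (auto simp: conj_class_def)

lemma O_subset: "\<O> \<subseteq> carrier G"
  using union_of_conj_classes conj_class_subset by blast

lemma O_conj:
  assumes "g \<in> \<O>" "h \<in> carrier G"
  shows "h \<otimes> g \<otimes> inv h \<in> \<O>"
proof -
  obtain T where T: "T \<subseteq> carrier G" "\<O> = (\<Union>g\<in>T. conj_class G g)"
    using union_of_conj_classes by blast
  then obtain t k where tk: "t \<in> T" "k \<in> carrier G" "g = k \<otimes> t \<otimes> inv k"
    using assms(1) by (auto simp: conj_class_def)
  have "t \<in> carrier G" using T tk by blast
  then have "h \<otimes> g \<otimes> inv h = (h \<otimes> k) \<otimes> t \<otimes> inv (h \<otimes> k)"
    using tk assms(2) by (simp add: m_assoc inv_mult_group)
  then have "h \<otimes> g \<otimes> inv h \<in> conj_class G t"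
    using tk assms(2) by (auto simp: conj_class_def)
  then show ?thesis using T tk by blast
qed

lemma O_conj_inv: "g \<in> \<O> \<Longrightarrow> h \<in> carrier G \<Longrightarrow> inv h \<otimes> g \<otimes> h \<in> \<O>"
  using O_conj[of g "inv h"] by simp

lemma word_val_group_hom: "group_hom (free_group \<O>) G (word_val G)"
  using word_val_hom[OF O_subset] group_free_group is_group
  by (simp add: group_hom_def group_hom_axioms_def)

lemma word_val_surj: "word_val G ` carrier (free_group \<O>) = carrier G"
proof -
  interpret h: group_hom "free_group \<O>" G "word_val G" by (rule word_val_group_hom)
  have "\<O> \<subseteq> word_val G ` carrier (free_group \<O>)"
  proof
    fix g assume "g \<in> \<O>"
    then show "g \<in> word_val G ` carrier (free_group \<O>)"
      using free_gen_in_carrier[of g \<O>] word_val_free_gen[of g] O_subset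
      by (intro image_eqI[of _ _ "free_gen g"]) auto
  qed
  then have "generate G \<O> \<subseteq> word_val G ` carrier (free_group \<O>)"
    by (rule generate_subgroup_incl[OF _ h.img_is_subgroup])
  then show ?thesis using generates by auto
qed

abbreviation (input) relators
  where "relators \<equiv> {u \<otimes>\<^bsub>free_group \<O>\<^esub> inv\<^bsub>free_group \<O>\<^esub> v | u v. (u, v) \<in> cover_relations G \<O>}"

lemma relators_subset_kernel: "relators \<subseteq> kernel (free_group \<O>) G (word_val G)"
proof
  interpret h: group_hom "free_group \<O>" G "word_val G" by (rule word_val_group_hom)
  fix r assume "r \<in> relators"
  then obtain u v where r: "r = u \<otimes>\<^bsub>free_group \<O>\<^esub> inv\<^bsub>free_group \<O>\<^esub> v" "(u, v) \<in> cover_relations G \<O>"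
    by blast
  then have "u \<in> carrier (free_group \<O>) \<and> v \<in> carrier (free_group \<O>) \<and> word_val G u = word_val G v"
  proof (unfold cover_relations_def, elim UnE CollectE exE conjE)
    fix g h assume *: "(u, v) = (free_gen g \<otimes>\<^bsub>free_group \<O>\<^esub> free_gen h,
      free_gen h \<otimes>\<^bsub>free_group \<O>\<^esub> free_gen (inv h \<otimes> g \<otimes> h))" "g \<in> \<O>" "h \<in> \<O>"
    then have gh: "g \<in> carrier G" "h \<in> carrier G" "inv h \<otimes> g \<otimes> h \<in> \<O>"
      using O_subset O_conj_inv by auto
    then show ?thesis
      using * free_gen_in_carrier[of _ \<O>] by (simp add: word_val_free_gen m_assoc[symmetric])
  next
    fix g h assume *: "(u, v) = (free_gen g \<otimes>\<^bsub>free_group \<O>\<^esub> free_gen h,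
      free_gen (g \<otimes> h \<otimes> inv g) \<otimes>\<^bsub>free_group \<O>\<^esub> free_gen g)" "g \<in> \<O>" "h \<in> \<O>"
    then have gh: "g \<in> carrier G" "h \<in> carrier G" "g \<otimes> h \<otimes> inv g \<in> \<O>"
      using O_subset O_conj by auto
    then show ?thesis
      using * free_gen_in_carrier[of _ \<O>] by (simp add: word_val_free_gen m_assoc)
  qed
  then show "r \<in> kernel (free_group \<O>) G (word_val G)"
    using r by (simp add: kernel_def)
qed

lemma normal_closure_relators_normal: "normal_closure (free_group \<O>) relators \<lhd> free_group \<O>"
  using relators_subset_kernel
  by (intro group.normal_closure_normal group_free_group) (auto simp: kernel_def)

lemma normal_closure_relators_subset:
  "normal_closure (free_group \<O>) relators \<subseteq> kernel (free_group \<O>) G (word_val G)"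
  by (intro group.normal_closure_subset group_free_group relators_subset_kernel
      group_hom.normal_kernel word_val_group_hom)

lemma group_cover_group: "group (cover_group G \<O>)"
  unfolding cover_group_def presented_group_def
  by (rule normal.factorgroup_is_group[OF normal_closure_relators_normal])

lemma cover_hom_coset:
  assumes w: "w \<in> carrier (free_group \<O>)"
  shows "cover_hom G (normal_closure (free_group \<O>) relators #>\<^bsub>free_group \<O>\<^esub> w) = word_val G w"
proof -
  interpret h: group_hom "free_group \<O>" G "word_val G" by (rule word_val_group_hom)
  interpret N: normal "normal_closure (free_group \<O>) relators" "free_group \<O>"
    by (rule normal_closure_relators_normal)
  have "word_val G ` (normal_closure (free_group \<O>) relators #>\<^bsub>free_group \<O>\<^esub> w) = {word_val G w}"
  proof -
    have "(\<lambda>n. word_val G (n \<otimes>\<^bsub>free_group \<O>\<^esub> w)) ` normal_closure (free_group \<O>) relators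
        = {word_val G w}"
    proof (rule image_eq_singleton[OF _ N.one_closed])
      show "word_val G (n \<otimes>\<^bsub>free_group \<O>\<^esub> w) = word_val G w"
        if "n \<in> normal_closure (free_group \<O>) relators" for n
        using that normal_closure_relators_subset w by (auto simp: kernel_def)
    qed
    then show ?thesis by (simp only: r_coset_def UNION_singleton_eq_range image_image)
  qed
  then show ?thesis by (simp add: cover_hom_def)
qed

lemma cover_hom_hom: "cover_hom G \<in> hom (cover_group G \<O>) G"
proof -
  interpret h: group_hom "free_group \<O>" G "word_val G" by (rule word_val_group_hom)
  interpret N: normal "normal_closure (free_group \<O>) relators" "free_group \<O>"
    by (rule normal_closure_relators_normal)
  show ?thesis
    unfolding cover_group_def presented_group_def
    by (rule homI) (auto simp: carrier_FactGroup cover_hom_coset N.rcos_sum)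
qed

lemma cover_hom_gen: "g \<in> \<O> \<Longrightarrow> cover_hom G (cover_gen G \<O> g) = g"
  using cover_hom_coset[of "free_gen g"] O_subset free_gen_in_carrier[of g \<O>] word_val_free_gen[of g]
  by (auto simp: cover_gen_def)

lemma relator_subgroup_normal: "relator_subgroup G \<O> \<lhd> free_group \<O>"
  unfolding relator_subgroup_def by (rule group_hom.normal_kernel[OF word_val_group_hom])

lemma group_hopf_numerator:
  "subgroup (relator_subgroup G \<O> \<inter> derived (free_group \<O>) (carrier (free_group \<O>))) (free_group \<O>)"
  by (rule group.subgroups_Inter_pair[OF group_free_group
        normal_imp_subgroup[OF relator_subgroup_normal]
        group.derived_is_subgroup[OF group_free_group order_refl]])

lemma hopf_denominator_normal:
  "hopf_denominator G \<O> \<lhd>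
    (free_group \<O>\<lparr>carrier := relator_subgroup G \<O> \<inter> derived (free_group \<O>) (carrier (free_group \<O>))\<rparr>)"
proof -
  interpret F: group "free_group \<O>" by (rule group_free_group)
  interpret R: normal "relator_subgroup G \<O>" "free_group \<O>" by (rule relator_subgroup_normal)
  let ?F = "free_group \<O>"
  let ?C = "{commutator ?F a b | a b. a \<in> carrier ?F \<and> b \<in> relator_subgroup G \<O>}"
  let ?D = "relator_subgroup G \<O> \<inter> derived ?F (carrier ?F)"
  have R_carrier: "b \<in> carrier ?F" if "b \<in> relator_subgroup G \<O>" for b
    using that R.subset by blast
  have C_carrier: "?C \<subseteq> carrier ?F"
    using R_carrier by (auto simp: commutator_def)
  have C_D: "?C \<subseteq> ?D"
  proof clarify
    fix a b assume ab: "a \<in> carrier ?F" "b \<in> relator_subgroup G \<O>"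
    have "a \<otimes>\<^bsub>?F\<^esub> b \<otimes>\<^bsub>?F\<^esub> inv\<^bsub>?F\<^esub> a \<in> relator_subgroup G \<O>"
      using ab R.inv_op_closed2 by blast
    then have "commutator ?F a b \<in> relator_subgroup G \<O>"
      using ab by (simp add: commutator_def)
    moreover have "commutator ?F a b \<in> derived ?F (carrier ?F)"
      unfolding derived_def commutator_def using ab R_carrier by (intro generate.incl) blast
    ultimately show "commutator ?F a b \<in> ?D" by blast
  qed
  have normal_F: "generate ?F ?C \<lhd> ?F"
  proof (rule F.normal_generateI[OF C_carrier])
    fix c x assume "c \<in> ?C" and x: "x \<in> carrier ?F"
    then obtain a b where c: "c = commutator ?F a b" "a \<in> carrier ?F" "b \<in> relator_subgroup G \<O>"
      by blast
    have b: "b \<in> carrier ?F" using c R_carrier by blast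
    have cancel: "inv\<^bsub>?F\<^esub> x \<otimes>\<^bsub>?F\<^esub> (x \<otimes>\<^bsub>?F\<^esub> z) = z" if "z \<in> carrier ?F" for z
      using x that by (simp add: F.m_assoc[symmetric])
    have "x \<otimes>\<^bsub>?F\<^esub> c \<otimes>\<^bsub>?F\<^esub> inv\<^bsub>?F\<^esub> x =
        commutator ?F (x \<otimes>\<^bsub>?F\<^esub> a \<otimes>\<^bsub>?F\<^esub> inv\<^bsub>?F\<^esub> x) (x \<otimes>\<^bsub>?F\<^esub> b \<otimes>\<^bsub>?F\<^esub> inv\<^bsub>?F\<^esub> x)"
      using x b c(2)
      by (simp add: c(1) commutator_def F.inv_mult_group F.m_assoc cancel)
    moreover have "x \<otimes>\<^bsub>?F\<^esub> a \<otimes>\<^bsub>?F\<^esub> inv\<^bsub>?F\<^esub> x \<in> carrier ?F" using x c by simp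
    moreover have "x \<otimes>\<^bsub>?F\<^esub> b \<otimes>\<^bsub>?F\<^esub> inv\<^bsub>?F\<^esub> x \<in> relator_subgroup G \<O>"
      using x c R.inv_op_closed2 by blast
    ultimately show "x \<otimes>\<^bsub>?F\<^esub> c \<otimes>\<^bsub>?F\<^esub> inv\<^bsub>?F\<^esub> x \<in> ?C" by blast
  qed
  have "generate ?F ?C \<subseteq> ?D"
    using F.generate_subgroup_incl[OF C_D group_hopf_numerator] .
  then show ?thesis
    unfolding hopf_denominator_def mixed_commutator_subgroup_def
    by (intro F.normal_restrict_supergroup group_hopf_numerator normal_F)
qed

lemma group_hopf_H2: "group (hopf_H2 G \<O>)"
  unfolding hopf_H2_def by (rule normal.factorgroup_is_group[OF hopf_denominator_normal])

end

lemma comm_group_rat_group: "comm_group rat_group"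
proof (rule comm_groupI)
  fix x :: rat assume "x \<in> carrier rat_group"
  show "\<exists>y\<in>carrier rat_group. y \<otimes>\<^bsub>rat_group\<^esub> x = \<one>\<^bsub>rat_group\<^esub>"
    by (intro bexI[of _ "- x"]) (simp_all add: rat_group_def)
qed (simp_all add: rat_group_def)

lemma Ints_subgroup_rat_group: "subgroup \<int> rat_group"
proof -
  interpret comm_group rat_group by (rule comm_group_rat_group)
  have "inv\<^bsub>rat_group\<^esub> x = - x" for x
    by (rule inv_equality) (simp_all add: rat_group_def)
  then show ?thesis by (intro subgroupI) (auto simp: rat_group_def)
qed

lemma comm_group_Q_mod_Z: "comm_group Q_mod_Z"
  unfolding Q_mod_Z_def
  by (rule comm_group.abelian_FactGroup[OF comm_group_rat_group Ints_subgroup_rat_group])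

end

theory Submission
  imports Defs
begin

text \<open>Write \<open>F\<close> for the free group on \<open>\<O>\<close>, \<open>R\<close> for the kernel of \<open>F \<rightarrow> G\<close> and \<open>N\<close> for the normal closure of
  the relators, so that the cover is \<open>F/N\<close>. In the cover the conjugate of a generator \<open>y\<^sub>g\<close> by a word \<open>w\<close>
  depends on the value of \<open>w\<close> in \<open>G\<close> only (\<open>cover_relations_conjugation\<close>). Hence \<open>R\<close> becomes central,
  \<open>[F, R] \<le> N\<close>, and the abelian group whose order is the ambiguity index, the image of \<open>R \<inter> [F, F]\<close>
  in \<open>F/N\<close>, is a quotient of \<open>H\<^sub>2 = (R \<inter> [F, F])/[F, R]\<close>. Two facts remain: the kernel of this
  quotient map is \<open>K\<close>, and a finite abelian group \<open>Q\<close> has as many elements as \<open>Hom(Q, \<rat>/\<int>)\<close>, while an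
  infinite one has infinitely many homomorphisms to \<open>\<rat>/\<int>\<close>. Indeed, the members of \<open>B\<close> are the homomorphisms from \<open>H\<^sub>2\<close> to \<open>\<rat>/\<int>\<close> that vanish on \<open>K\<close>, that is, those that factor
  through the quotient (\<open>bij_betw_hom_factor\<close>).

  The kernel. Let \<open>L\<close> be generated by \<open>[F, R]\<close> and the commutators \<open>[w, x\<^sub>g]\<close> that lie in \<open>R\<close>. These
  commutators are trivial in the cover, where \<open>y\<^sub>g\<close> commutes with \<open>w\<close> as soon as \<open>g\<close> commutes with the
  value of \<open>w\<close>; so \<open>L \<le> N\<close>. The converse \<open>N \<inter> [F, F] \<le> L\<close> is the heart of the proof
  (\<open>trivial_on_relations_in_derived\<close>). In \<open>F/L\<close> the image of \<open>R\<close> is central and \<open>x\<^sub>g\<close> commutes with all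
  words whose value commutes with \<open>g\<close>. Therefore, after a choice of one element in every conjugacy class,
  transport by conjugation gives a well-defined lift \<open>s g\<close> of every \<open>g \<in> \<O>\<close> to \<open>F/L\<close>, compatible with
  conjugation (\<open>equivariant_section\<close>). These lifts satisfy the defining relations of the
  cover, so the homomorphism \<open>\<psi>: F \<rightarrow> F/L\<close> with \<open>x\<^sub>g \<mapsto> s g\<close> kills \<open>N\<close>. But \<open>s g\<close> and \<open>x\<^sub>g\<close> differ by a central
  element, so \<open>\<psi>\<close> agrees with the projection \<open>F \<rightarrow> F/L\<close> on all commutators, and an element of
  \<open>N \<inter> [F, F]\<close> must be trivial in \<open>F/L\<close>.

  The count. As \<open>\<rat>/\<int>\<close> is isomorphic to the group of complex roots of unity, homomorphisms to it may be
  summed. Characters separate points, because the group of roots of unity is divisible and Zorn's lemma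
  applies. For a finite group, summing \<open>\<chi> a\<close> over all characters \<open>\<chi>\<close> and all elements \<open>a\<close> in the two possible
  orders gives the number of elements on the one hand and the number of characters on the other; and a
  group whose points are separated by finitely many characters is finite (\<open>card_characters\<close>).\<close>


section \<open>The group of complex roots of unity\<close>

definition roots_of_unity :: "complex monoid"
  where "roots_of_unity = \<lparr>carrier = {z. \<exists>n>0. z ^ n = 1}, monoid.mult = (*), one = 1\<rparr>"

lemma carrier_roots_of_unity: "z \<in> carrier roots_of_unity \<longleftrightarrow> (\<exists>n>0. z ^ n = 1)"
  and mult_roots_of_unity [simp]: "y \<otimes>\<^bsub>roots_of_unity\<^esub> z = y * z"
  and one_roots_of_unity [simp]: "\<one>\<^bsub>roots_of_unity\<^esub> = 1"
  by (simp_all add: roots_of_unity_def)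

lemma comm_group_roots_of_unity: "comm_group roots_of_unity"
proof (rule comm_groupI)
  fix y z assume "y \<in> carrier roots_of_unity" "z \<in> carrier roots_of_unity"
  then obtain m n where mn: "m > 0" "n > 0" "y ^ m = 1" "z ^ n = 1"
    by (auto simp: carrier_roots_of_unity)
  then have "(y * z) ^ (m * n) = 1"
    by (simp add: power_mult_distrib power_mult) (metis mult.commute power_mult power_one)
  then show "y \<otimes>\<^bsub>roots_of_unity\<^esub> z \<in> carrier roots_of_unity"
    using mn by (auto simp: carrier_roots_of_unity intro!: exI[of _ "m * n"])
next
  fix z assume "z \<in> carrier roots_of_unity"
  then obtain n where n: "n > 0" "z ^ n = 1" by (auto simp: carrier_roots_of_unity)
  then have "z \<noteq> 0" by (auto simp: power_0_left)
  moreover have "inverse z \<in> carrier roots_of_unity"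
    using n by (auto simp: carrier_roots_of_unity power_inverse)
  ultimately show "\<exists>y\<in>carrier roots_of_unity. y \<otimes>\<^bsub>roots_of_unity\<^esub> z = \<one>\<^bsub>roots_of_unity\<^esub>"
    by (intro bexI[of _ "inverse z"]) auto
qed (auto simp: carrier_roots_of_unity)

interpretation U: comm_group roots_of_unity
  by (rule comm_group_roots_of_unity)

lemma nat_pow_roots_of_unity: "z [^]\<^bsub>roots_of_unity\<^esub> (n::nat) = z ^ n"
  by (induction n) (simp_all add: U.nat_pow_Suc mult.commute)

lemma roots_of_unity_nonzero: "z \<in> carrier roots_of_unity \<Longrightarrow> z \<noteq> 0"
  by (auto simp: carrier_roots_of_unity power_0_left)

lemma roots_of_unity_root:
  assumes "z \<in> carrier roots_of_unity" "u ^ m = z" "m > 0"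
  shows "u \<in> carrier roots_of_unity"
proof -
  obtain n where "n > 0" "z ^ n = 1" using assms(1) by (auto simp: carrier_roots_of_unity)
  then have "m * n > 0" "u ^ (m * n) = 1" using assms by (auto simp: power_mult)
  then show ?thesis unfolding carrier_roots_of_unity by blast
qed

text \<open>Divisibility, with room for a choice: a nonzero number has \<open>m \<ge> 2\<close> different \<open>m\<close>-th roots, and for
  \<open>m = 0\<close> any \<open>u\<close> will do. The freedom to avoid a value \<open>w\<close> is what later makes a character
  nontrivial at a given point.\<close>

lemma exists_root_of_unity_avoiding:
  assumes z: "z \<in> carrier roots_of_unity" and m: "m \<noteq> 1" "m = 0 \<Longrightarrow> z = 1"
  shows "\<exists>u\<in>carrier roots_of_unity. u ^ m = z \<and> u \<noteq> w"
proof (cases "m = 0")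
  case True
  have "1 \<in> carrier roots_of_unity" "-1 \<in> carrier roots_of_unity"
    by (auto simp: carrier_roots_of_unity intro: exI[of _ 2])
  moreover have "w \<noteq> 1 \<or> w \<noteq> -1" by auto
  ultimately show ?thesis using m True by (metis power_0)
next
  case False
  have card: "card {u. u ^ m = z} = m"
    using False roots_of_unity_nonzero[OF z] by (intro card_nth_roots) auto
  have "\<not> {u. u ^ m = z} \<subseteq> {w}"
    using card_mono[of "{w}" "{u. u ^ m = z}"] card False m by auto
  then show ?thesis using roots_of_unity_root[OF z] False by blast
qed

text \<open>The isomorphism is induced by \<open>x \<mapsto> exp (2\<pi>\<i>x)\<close>, whose kernel on \<open>\<rat>\<close> is \<open>\<int>\<close>.\<close>

lemma Q_mod_Z_iso_roots_of_unity: "Q_mod_Z \<cong> roots_of_unity"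
proof -
  let ?e = "\<lambda>x::rat. cis (2 * pi * of_rat x)"
  have "?e x \<in> carrier roots_of_unity" for x
  proof -
    obtain p q where pq: "q > 0" "x = of_int p / of_int q"
      by (metis quotient_of_div quotient_of_denom_pos prod.collapse)
    have "real (nat q) * (2 * pi * of_rat x) = 2 * pi * of_int p"
      using pq by (simp add: of_rat_divide)
    then have "?e x ^ nat q = 1"
      unfolding DeMoivre by (simp only: cis_multiple_2pi Ints_of_int)
    then show ?thesis using pq by (auto simp: carrier_roots_of_unity intro!: exI[of _ "nat q"])
  qed
  then have hom: "?e \<in> hom rat_group roots_of_unity"
    by (intro homI) (auto simp: rat_group_def cis_mult of_rat_add algebra_simps)
  interpret e: group_hom rat_group roots_of_unity ?e
    using hom comm_group_rat_group by (simp add: group_hom_def group_hom_axioms_def comm_group_def)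
  have "z \<in> ?e ` carrier rat_group" if z: "z \<in> carrier roots_of_unity" for z
  proof -
    obtain n where n: "n > 0" "z ^ n = 1" using z by (auto simp: carrier_roots_of_unity)
    then obtain k where k: "z = cis (2 * pi * real k / real n)"
      using bij_betw_roots_unity[OF n(1)] by (auto simp: bij_betw_def)
    then have "z = ?e (of_nat k / of_nat n)" by (simp add: of_rat_divide)
    then show ?thesis by (simp add: rat_group_def)
  qed
  then have "?e ` carrier rat_group = carrier roots_of_unity"
    using e.hom_closed by blast
  moreover have "kernel rat_group roots_of_unity ?e = \<int>"
  proof -
    have "?e x = 1 \<longleftrightarrow> x \<in> \<int>" for x
    proof
      assume "?e x = 1"
      then have "cos (2 * pi * of_rat x) = 1" by (metis cis.sel(1) one_complex.sel(1))
      then obtain i :: int where "2 * pi * of_rat x = of_int i * 2 * pi"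
        using cos_one_2pi_int by auto
      then have "(of_rat x :: real) = of_rat (of_int i)" by simp
      then show "x \<in> \<int>" unfolding of_rat_eq_iff by simp
    next
      assume "x \<in> \<int>"
      then show "?e x = 1" by (auto elim!: Ints_cases)
    qed
    then show ?thesis by (simp add: kernel_def rat_group_def)
  qed
  ultimately show ?thesis using e.FactGroup_iso by (simp add: Q_mod_Z_def)
qed


section \<open>Characters separate the points of an abelian group\<close>

abbreviation characters :: "('a, 'b) monoid_scheme \<Rightarrow> ('a \<Rightarrow> complex) set"
  where "characters A \<equiv> hom A roots_of_unity \<inter> extensional (carrier A)"

text \<open>A character of a subgroup of \<open>A\<close>, given by its graph: a subgroup \<open>P\<close> of \<open>A \<times> \<mu>\<close>, where \<open>\<mu>\<close> is the group
  of roots of unity, is the graph of a partial function iff it meets \<open>1 \<times> \<mu>\<close> trivially. Extension of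
  characters then is inclusion of sets, which suits Zorn's lemma.\<close>

definition partial_character :: "('a, 'b) monoid_scheme \<Rightarrow> ('a \<times> complex) set \<Rightarrow> bool"
  where "partial_character A P \<longleftrightarrow>
    subgroup P (A \<times>\<times> roots_of_unity) \<and> (\<forall>z. (\<one>\<^bsub>A\<^esub>, z) \<in> P \<longrightarrow> z = 1)"

lemma (in comm_group) subgroup_adjoin:
  assumes P: "subgroup P G" and t: "t \<in> carrier G"
  shows "subgroup {p \<otimes> t [^] k | p (k::int). p \<in> P} G"
proof (rule subgroupI)
  have Pc: "p \<in> carrier G" if "p \<in> P" for p using subgroup.mem_carrier[OF P that] .
  show "{p \<otimes> t [^] k | p (k::int). p \<in> P} \<subseteq> carrier G" using t Pc by auto
  show "{p \<otimes> t [^] k | p (k::int). p \<in> P} \<noteq> {}" using subgroup.one_closed[OF P] by blast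
  fix x assume "x \<in> {p \<otimes> t [^] k | p (k::int). p \<in> P}"
  then obtain p k where x: "x = p \<otimes> t [^] (k::int)" "p \<in> P" by blast
  then have "inv x = inv p \<otimes> t [^] (-k)"
    using t Pc by (simp add: inv_mult int_pow_neg)
  then show "inv x \<in> {p \<otimes> t [^] k | p (k::int). p \<in> P}"
    using subgroup.m_inv_closed[OF P x(2)] by blast
  fix y assume "y \<in> {p \<otimes> t [^] k | p (k::int). p \<in> P}"
  then obtain q l where y: "y = q \<otimes> t [^] (l::int)" "q \<in> P" by blast
  have "x \<otimes> y = (p \<otimes> q) \<otimes> t [^] (k + l)"
    using t Pc x y by (simp add: int_pow_mult m_ac)
  then show "x \<otimes> y \<in> {p \<otimes> t [^] k | p (k::int). p \<in> P}"
    using subgroup.m_closed[OF P x(2) y(2)] by blast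
qed

text \<open>The number \<open>m\<close> is the order of \<open>a\<close> modulo \<open>H\<close>; it is \<open>0\<close> if no power of \<open>a\<close> other than the zeroth lies in
  \<open>H\<close>, so that both cases can be treated alike.\<close>

lemma (in group) order_modulo_subgroup:
  assumes "H \<lhd> G" and a: "a \<in> carrier G"
  shows "\<exists>m::nat. \<forall>k::int. a [^] k \<in> H \<longleftrightarrow> int m dvd k"
proof -
  interpret N: normal H G by fact
  interpret q: group_hom G "G Mod H" "(\<lambda>x. H #> x)"
    using N.r_coset_hom_Mod N.factorgroup_is_group is_group
    by (simp add: group_hom_def group_hom_axioms_def)
  have "a [^] k \<in> H \<longleftrightarrow> (H #> a) [^]\<^bsub>G Mod H\<^esub> k = \<one>\<^bsub>G Mod H\<^esub>" for k :: int
    using a coset_join1[of H "a [^] k"] coset_join2[of "a [^] k" H] N.subgroup_axioms N.subset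
    by (auto simp flip: q.hom_int_pow)
  then show ?thesis
    using q.H.int_pow_eq_id[of "H #> a"] a by auto
qed

context comm_group
begin

lemma DirProd_roots_of_unity: "comm_group (G \<times>\<times> roots_of_unity)"
proof -
  interpret D: group "G \<times>\<times> roots_of_unity" by (rule DirProd_group[OF is_group U.is_group])
  show ?thesis by (rule D.group_comm_groupI) (auto simp: m_comm mult.commute)
qed

text \<open>If \<open>m\<close> is the order of \<open>a\<close> modulo the domain of \<open>P\<close>, then the value \<open>z\<close> at \<open>a\<^sup>m\<close> is prescribed by \<open>P\<close>, and any
  \<open>u\<close> with \<open>u\<^sup>m = z\<close> can be taken as value at \<open>a\<close>. The extension is generated by \<open>P\<close> and \<open>(a, u)\<close>.\<close>

lemma partial_character_extend:
  assumes P: "partial_character G P" and a: "a \<in> carrier G" "a \<notin> fst ` P"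
  shows "\<exists>P' u. partial_character G P' \<and> P \<subseteq> P' \<and> (a, u) \<in> P' \<and> u \<noteq> w"
proof -
  let ?D = "G \<times>\<times> roots_of_unity"
  interpret D: comm_group ?D by (rule DirProd_roots_of_unity)
  interpret P: subgroup P ?D using P by (simp add: partial_character_def)
  interpret fst: group_hom ?D G fst
    by unfold_locales (auto simp: hom_def mult_DirProd')
  interpret snd: group_hom ?D roots_of_unity snd
    by unfold_locales (auto simp: hom_def mult_DirProd')
  have H: "fst ` P \<lhd> G"
    using subgroup_imp_normal[OF fst.subgroup_img_is_subgroup[OF P.subgroup_axioms]] .
  obtain m :: nat where m: "\<And>k::int. a [^] k \<in> fst ` P \<longleftrightarrow> int m dvd k"
    using order_modulo_subgroup[OF H a(1)] by blast
  have "a [^] int m \<in> fst ` P" using m by simp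
  then obtain z where z: "(a [^] m, z) \<in> P" by (auto simp: int_pow_int)
  have "z \<in> carrier roots_of_unity" using P.subset z by auto
  moreover have "m \<noteq> 1" using m[of 1] a by simp
  moreover have "z = 1" if "m = 0" using z that P by (simp add: partial_character_def)
  ultimately obtain u where u: "u \<in> carrier roots_of_unity" "u ^ m = z" "u \<noteq> w"
    using exists_root_of_unity_avoiding by blast
  let ?t = "(a, u)" and ?P' = "{p \<otimes>\<^bsub>?D\<^esub> (a, u) [^]\<^bsub>?D\<^esub> k | p (k::int). p \<in> P}"
  have t: "?t \<in> carrier ?D" using a u by simp
  have tm: "?t [^]\<^bsub>?D\<^esub> m \<in> P"
    using z u fst.hom_nat_pow[OF t, of m] snd.hom_nat_pow[OF t, of m]
    by (metis fst_conv nat_pow_roots_of_unity prod.collapse snd_conv)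
  have "partial_character G ?P'"
    unfolding partial_character_def
  proof (intro conjI allI impI)
    show "subgroup ?P' ?D" by (rule D.subgroup_adjoin[OF P.subgroup_axioms t])
    fix y assume "(\<one>, y) \<in> ?P'"
    then obtain p k where pk: "(\<one>, y) = p \<otimes>\<^bsub>?D\<^esub> ?t [^]\<^bsub>?D\<^esub> (k::int)" "p \<in> P" by blast
    \<comment> \<open>As \<open>a [^] k\<close> lies in the domain of \<open>P\<close>, \<open>k\<close> is a multiple of \<open>m\<close>, and \<open>(a, u) [^] m \<in> P\<close> by the choice of \<open>u\<close>.\<close>
    have "fst p \<otimes> a [^] k = \<one>"
      using fst.hom_int_pow[OF t, of k] pk(1) by (metis fst_conv mult_DirProd')
    moreover have "fst p \<in> fst ` P" "fst p \<in> carrier G"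
      using pk(2) P.subset by auto
    ultimately have "a [^] k \<in> fst ` P"
      using normal_imp_subgroup[OF H] a
      by (metis int_pow_closed inv_equality inv_inv subgroup.m_inv_closed inv_closed)
    then obtain j where j: "k = int m * j" using m by (auto simp: dvd_def)
    have "?t [^]\<^bsub>?D\<^esub> k = (?t [^]\<^bsub>?D\<^esub> m) [^]\<^bsub>?D\<^esub> j"
      using t by (simp only: j D.int_pow_pow[OF t, symmetric] int_pow_int)
    also have "\<dots> \<in> P"
      using tm D.subgroup_int_pow_closed[OF P.subgroup_axioms] by blast
    finally have "(\<one>, y) \<in> P" using pk by simp
    then show "y = 1" using P by (simp add: partial_character_def)
  qed
  moreover have "P \<subseteq> ?P'"
  proof
    fix p assume p: "p \<in> P"
    then have "p = p \<otimes>\<^bsub>?D\<^esub> ?t [^]\<^bsub>?D\<^esub> (0::int)"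
      using P.mem_carrier[OF p] D.r_one[of p] by (simp only: int_pow_0)
    then show "p \<in> ?P'" using p by blast
  qed
  moreover have "?t \<in> ?P'"
  proof -
    have "?t = \<one>\<^bsub>?D\<^esub> \<otimes>\<^bsub>?D\<^esub> ?t [^]\<^bsub>?D\<^esub> (1::int)"
      using t D.int_pow_1[OF t] D.l_one[OF t] by (simp only:)
    then show ?thesis using P.one_closed by blast
  qed
  ultimately show ?thesis using u(3) by (intro exI[of _ ?P'] exI[of _ u]) blast
qed

lemma partial_character_Union:
  assumes ne: "C \<noteq> {}" and C: "subset.chain {P. partial_character G P \<and> Q \<subseteq> P} C"
  shows "partial_character G (\<Union>C)"
  unfolding partial_character_def
proof (intro conjI allI impI)
  let ?D = "G \<times>\<times> roots_of_unity"
  interpret D: comm_group ?D by (rule DirProd_roots_of_unity)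
  have sub: "subgroup P ?D" if "P \<in> C" for P
    using that C by (auto simp: subset.chain_def partial_character_def)
  show "subgroup (\<Union>C) ?D"
  proof (rule D.subgroupI)
    show "\<Union>C \<subseteq> carrier ?D" using sub subgroup.subset by blast
    show "\<Union>C \<noteq> {}" using ne sub subgroup.one_closed by blast
    fix x assume "x \<in> \<Union>C"
    then obtain P where P: "x \<in> P" "P \<in> C" by blast
    then show "inv\<^bsub>?D\<^esub> x \<in> \<Union>C" using subgroup.m_inv_closed[OF sub[OF P(2)] P(1)] by blast
    fix y assume "y \<in> \<Union>C"
    then obtain P' where P': "y \<in> P'" "P' \<in> C" by blast
    have "P \<subseteq> P' \<or> P' \<subseteq> P" using C P P' unfolding subset.chain_def by blast
    then show "x \<otimes>\<^bsub>?D\<^esub> y \<in> \<Union>C"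
      using P P' sub[OF P(2)] sub[OF P'(2)] subgroup.m_closed by (metis UnionI subsetD)
  qed
  show "z = 1" if "(\<one>, z) \<in> \<Union>C" for z
    using that C by (auto simp: subset.chain_def partial_character_def)
qed

lemma character_of_total_partial_character:
  assumes P: "partial_character G P" and total: "fst ` P = carrier G"
  shows "\<exists>\<chi>\<in>characters G. \<forall>(x, z)\<in>P. \<chi> x = z"
proof -
  let ?D = "G \<times>\<times> roots_of_unity"
  interpret D: comm_group ?D by (rule DirProd_roots_of_unity)
  interpret P: subgroup P ?D using P by (simp add: partial_character_def)
  have carr: "x \<in> carrier G \<and> z \<in> carrier roots_of_unity" if "(x, z) \<in> P" for x z
    using that P.subset by auto
  have unique: "y = z" if yz: "(x, y) \<in> P" "(x, z) \<in> P" for x y z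
  proof -
    have "(x, y) \<otimes>\<^bsub>?D\<^esub> inv\<^bsub>?D\<^esub> (x, z) \<in> P"
      using yz P.m_closed P.m_inv_closed by blast
    then have "(\<one>, y \<otimes>\<^bsub>roots_of_unity\<^esub> inv\<^bsub>roots_of_unity\<^esub> z) \<in> P"
      using carr[OF yz(1)] carr[OF yz(2)] by (simp add: inv_DirProd[OF is_group U.is_group])
    then have "y \<otimes>\<^bsub>roots_of_unity\<^esub> inv\<^bsub>roots_of_unity\<^esub> z = \<one>\<^bsub>roots_of_unity\<^esub>"
      using P by (simp only: partial_character_def one_roots_of_unity)
    then show "y = z"
      using carr[OF yz(1)] carr[OF yz(2)] by (metis U.inv_closed U.inv_equality U.inv_inv)
  qed
  define \<chi> where "\<chi> = (\<lambda>x\<in>carrier G. SOME z. (x, z) \<in> P)"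
  have \<chi>: "(x, \<chi> x) \<in> P" if "x \<in> carrier G" for x
  proof -
    from that total obtain z where "(x, z) \<in> P" by (metis imageE prod.collapse)
    then have "(x, SOME z. (x, z) \<in> P) \<in> P" by (rule someI)
    then show ?thesis using that by (simp add: \<chi>_def)
  qed
  have "\<chi> \<in> hom G roots_of_unity"
  proof (rule homI)
    show "\<chi> x \<in> carrier roots_of_unity" if "x \<in> carrier G" for x using \<chi> carr that by blast
    fix x y assume xy: "x \<in> carrier G" "y \<in> carrier G"
    show "\<chi> (x \<otimes> y) = \<chi> x \<otimes>\<^bsub>roots_of_unity\<^esub> \<chi> y"
      using P.m_closed[OF \<chi>[OF xy(1)] \<chi>[OF xy(2)]] \<chi>[of "x \<otimes> y"] xy unique by simp
  qed
  moreover have "\<chi> \<in> extensional (carrier G)" by (simp add: \<chi>_def)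
  moreover have "\<chi> x = z" if "(x, z) \<in> P" for x z
    using that \<chi> carr unique by blast
  ultimately show ?thesis by blast
qed

text \<open>Begin with the trivial character of the trivial subgroup, extend it to \<open>a\<close> with a value other than \<open>1\<close>,
  and then, by Zorn's lemma, as far as possible; by \<open>partial_character_extend\<close> a maximal partial
  character is defined everywhere.\<close>

lemma characters_separate_points:
  assumes a: "a \<in> carrier G" "a \<noteq> \<one>"
  shows "\<exists>\<chi>\<in>characters G. \<chi> a \<noteq> 1"
proof -
  let ?D = "G \<times>\<times> roots_of_unity"
  interpret D: comm_group ?D by (rule DirProd_roots_of_unity)
  have "partial_character G {\<one>\<^bsub>?D\<^esub>}"
    using D.triv_subgroup by (simp add: partial_character_def)
  then obtain Q u where Q: "partial_character G Q" "(a, u) \<in> Q" "u \<noteq> 1"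
    using partial_character_extend[of "{\<one>\<^bsub>?D\<^esub>}" a 1] a by auto
  let ?X = "{P. partial_character G P \<and> Q \<subseteq> P}"
  have "\<exists>M\<in>?X. \<forall>P\<in>?X. M \<subseteq> P \<longrightarrow> P = M"
  proof (rule subset_Zorn_nonempty)
    show "?X \<noteq> {}" using Q by blast
    fix C assume C: "C \<noteq> {}" "subset.chain ?X C"
    then have "Q \<subseteq> \<Union>C" by (fastforce simp: subset.chain_def)
    then show "\<Union>C \<in> ?X" using partial_character_Union[OF C] by blast
  qed
  then obtain M where MX: "M \<in> ?X" "\<forall>P\<in>?X. M \<subseteq> P \<longrightarrow> P = M" by (rule bexE)
  then have M: "partial_character G M" "Q \<subseteq> M" by simp_all
  have max: "P = M" if "partial_character G P" "M \<subseteq> P" for P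
  proof -
    have "P \<in> ?X" using that M(2) by simp
    then show ?thesis using MX(2) that(2) by simp
  qed
  have "fst ` M = carrier G"
  proof
    show "fst ` M \<subseteq> carrier G"
      using M subgroup.subset by (fastforce simp: partial_character_def)
    show "carrier G \<subseteq> fst ` M"
    proof (rule ccontr)
      assume "\<not> carrier G \<subseteq> fst ` M"
      then obtain b where b: "b \<in> carrier G" "b \<notin> fst ` M" by blast
      then obtain P v where "partial_character G P" "M \<subseteq> P" "(b, v) \<in> P"
        using partial_character_extend[OF M(1) b] by blast
      then show False using max[of P] b by (force simp: image_iff)
    qed
  qed
  then obtain \<chi> where "\<chi> \<in> characters G" "\<forall>(x, z)\<in>M. \<chi> x = z"
    using character_of_total_partial_character[OF M(1)] by (meson bexE)
  moreover have "(a, u) \<in> M" using Q M(2) by blast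
  ultimately show ?thesis using Q(3) by (intro bexI[of _ \<chi>]) auto
qed

end


section \<open>The number of characters of an abelian group\<close>

lemma characterD:
  assumes "\<chi> \<in> characters A"
  shows character_closed: "x \<in> carrier A \<Longrightarrow> \<chi> x \<in> carrier roots_of_unity"
    and character_mult: "x \<in> carrier A \<Longrightarrow> y \<in> carrier A \<Longrightarrow> \<chi> (x \<otimes>\<^bsub>A\<^esub> y) = \<chi> x * \<chi> y"
    and character_nonzero: "x \<in> carrier A \<Longrightarrow> \<chi> x \<noteq> 0"
  using assms roots_of_unity_nonzero by (auto simp: hom_def)

lemma (in group) character_one: "\<chi> \<in> characters G \<Longrightarrow> \<chi> \<one> = 1"
  using hom_one[OF _ is_group U.is_group, of \<chi>] by simp

lemma (in group) character_pow:
  "\<chi> \<in> characters G \<Longrightarrow> x \<in> carrier G \<Longrightarrow> \<chi> (x [^] (n::nat)) = \<chi> x ^ n"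
  by (induction n) (simp_all add: character_one character_mult nat_pow_Suc mult.commute)

lemma character_times:
  assumes "\<chi> \<in> characters A" "\<psi> \<in> characters A" "group A"
  shows "(\<lambda>x\<in>carrier A. \<chi> x * \<psi> x) \<in> characters A"
proof -
  interpret A: group A by fact
  have "\<chi> x * \<psi> x \<in> carrier roots_of_unity" if "x \<in> carrier A" for x
    using U.m_closed[OF character_closed[OF assms(1) that] character_closed[OF assms(2) that]] by simp
  then show ?thesis
    by (auto simp: hom_def character_mult[OF assms(1)] character_mult[OF assms(2)])
qed

text \<open>If \<open>\<chi> b \<noteq> 1\<close>, translation by \<open>b\<close> permutes the summands and multiplies the sum by \<open>\<chi> b\<close>, so that the sum
  vanishes.\<close>

lemma (in group) sum_character:
  assumes \<chi>: "\<chi> \<in> characters G" and fin: "finite (carrier G)"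
  shows "(\<Sum>x\<in>carrier G. \<chi> x) = (if \<forall>x\<in>carrier G. \<chi> x = 1 then of_nat (card (carrier G)) else 0)"
proof (cases "\<forall>x\<in>carrier G. \<chi> x = 1")
  case False
  then obtain b where b: "b \<in> carrier G" "\<chi> b \<noteq> 1" by blast
  have "(\<Sum>x\<in>carrier G. \<chi> x) = (\<Sum>x\<in>carrier G. \<chi> (b \<otimes> x))"
  proof (rule sum.reindex_bij_betw[symmetric])
    show "bij_betw (\<lambda>x. b \<otimes> x) (carrier G) (carrier G)"
      using b surj_const_mult
      by (simp add: bij_betw_def inj_on_cmult)
  qed
  also have "\<dots> = \<chi> b * (\<Sum>x\<in>carrier G. \<chi> x)"
    using \<chi> b by (simp add: character_mult sum_distrib_left)
  finally show ?thesis using b by auto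
qed simp

text \<open>The dual orthogonality relation, by multiplication with a character \<open>\<psi>\<close> such that \<open>\<psi> a \<noteq> 1\<close>. Here an
  injective self-map of the set of characters is onto because that set is finite.\<close>

lemma (in comm_group) sum_over_characters:
  assumes fin: "finite (characters G)" and a: "a \<in> carrier G"
  shows "(\<Sum>\<chi>\<in>characters G. \<chi> a) = (if a = \<one> then of_nat (card (characters G)) else 0)"
proof (cases "a = \<one>")
  case True
  then show ?thesis by (simp add: character_one)
next
  case False
  then obtain \<psi> where \<psi>: "\<psi> \<in> characters G" "\<psi> a \<noteq> 1"
    using characters_separate_points a by blast
  let ?f = "\<lambda>\<chi>. \<lambda>x\<in>carrier G. \<psi> x * \<chi> x"
  have "inj_on ?f (characters G)"
  proof (rule inj_onI)
    fix \<chi> \<chi>' assume *: "\<chi> \<in> characters G" "\<chi>' \<in> characters G" "?f \<chi> = ?f \<chi>'"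
    have "\<chi> x = \<chi>' x" if "x \<in> carrier G" for x
      using fun_cong[OF *(3), of x] that character_nonzero[OF \<psi>(1) that] by simp
    then show "\<chi> = \<chi>'" using * by (intro extensionalityI[of _ "carrier G"]) auto
  qed
  moreover have "?f ` characters G \<subseteq> characters G"
    using character_times[OF \<psi>(1) _ is_group] by blast
  ultimately have "bij_betw ?f (characters G) (characters G)"
    unfolding bij_betw_def using endo_inj_surj[OF fin] by blast
  then have "(\<Sum>\<chi>\<in>characters G. \<chi> a) = (\<Sum>\<chi>\<in>characters G. ?f \<chi> a)"
    by (rule sum.reindex_bij_betw[symmetric])
  also have "\<dots> = \<psi> a * (\<Sum>\<chi>\<in>characters G. \<chi> a)"
    using a by (simp add: sum_distrib_left)
  finally show ?thesis using \<psi>(2) False by simp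
qed

lemma (in group) finite_characters:
  assumes "finite (carrier G)"
  shows "finite (characters G)"
proof (rule finite_subset)
  have n: "order G > 0" using assms by (simp add: order_gt_0_iff_finite)
  show "characters G \<subseteq> carrier G \<rightarrow>\<^sub>E {z. z ^ order G = 1}"
  proof
    fix \<chi> assume \<chi>: "\<chi> \<in> characters G"
    have "\<chi> x ^ order G = 1" if "x \<in> carrier G" for x
      using character_pow[OF \<chi> that, of "order G"] pow_order_eq_1[OF that] character_one[OF \<chi>]
      by simp
    then show "\<chi> \<in> carrier G \<rightarrow>\<^sub>E {z. z ^ order G = 1}" using \<chi> by (auto simp: PiE_def)
  qed
  show "finite (carrier G \<rightarrow>\<^sub>E {z::complex. z ^ order G = 1})"
    using n assms by (intro finite_PiE finite_roots_unity) auto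
qed

text \<open>Two powers of \<open>\<chi>\<close> coincide, as there are only finitely many characters.\<close>

lemma (in group) character_torsion:
  assumes fin: "finite (characters G)" and \<chi>: "\<chi> \<in> characters G"
  shows "\<exists>n>0. \<forall>x\<in>carrier G. \<chi> x ^ n = 1"
proof -
  define f where "f n = (\<lambda>x\<in>carrier G. \<chi> x ^ n)" for n :: nat
  have "f n \<in> characters G" for n
  proof (induction n)
    case 0
    show ?case using U.one_closed by (simp add: f_def hom_def extensional_def)
  next
    case (Suc n)
    have "f (Suc n) = (\<lambda>x\<in>carrier G. \<chi> x * f n x)" by (auto simp: f_def)
    then show ?case using character_times[OF \<chi> Suc is_group] by (simp only:)
  qed
  then have "finite (range f)" by (intro finite_subset[OF _ fin] image_subsetI)
  then have "\<not> inj f" using finite_imageD infinite_UNIV_nat by blast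
  then obtain i j where ij: "i < j" "f i = f j"
    unfolding inj_def by (metis linorder_neqE_nat)
  have "\<chi> x ^ (j - i) = 1" if "x \<in> carrier G" for x
  proof -
    have "\<chi> x ^ i = \<chi> x ^ j" using fun_cong[OF ij(2), of x] that by (simp add: f_def)
    moreover have "\<chi> x ^ i * \<chi> x ^ (j - i) = \<chi> x ^ j" using ij(1) by (simp flip: power_add)
    ultimately show ?thesis using character_nonzero[OF \<chi> that] by simp
  qed
  then show ?thesis using ij(1) by (intro exI[of _ "j - i"]) auto
qed

text \<open>Evaluation embeds the group into the product, over the characters \<open>\<chi>\<close>, of the groups of \<open>n\<close>-th roots of unity,
  where \<open>n\<close> is an exponent for the values of \<open>\<chi>\<close>. For finitely many characters this is a finite product of finite sets.\<close>

lemma (in comm_group) finite_carrier_of_finite_characters: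
  assumes fin: "finite (characters G)"
  shows "finite (carrier G)"
proof -
  obtain n where n: "\<And>\<chi>. \<chi> \<in> characters G \<Longrightarrow> n \<chi> > 0 \<and> (\<forall>x\<in>carrier G. \<chi> x ^ n \<chi> = 1)"
    using character_torsion[OF fin] by metis
  let ?ev = "\<lambda>a. \<lambda>\<chi>\<in>characters G. \<chi> a"
  have "inj_on ?ev (carrier G)"
  proof (rule inj_onI, rule ccontr)
    fix a b assume ab: "a \<in> carrier G" "b \<in> carrier G" "?ev a = ?ev b" "a \<noteq> b"
    then have "a \<otimes> inv b \<noteq> \<one>" by (metis inv_equality inv_inv inv_closed)
    then obtain \<chi> where \<chi>: "\<chi> \<in> characters G" "\<chi> (a \<otimes> inv b) \<noteq> 1"
      using characters_separate_points ab by blast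
    have "\<chi> a = \<chi> b"
      using fun_cong[OF ab(3), of \<chi>] \<chi>(1) by simp
    then have "\<chi> (a \<otimes> inv b) = \<chi> (b \<otimes> inv b)"
      using character_mult[OF \<chi>(1)] ab(1,2) by (simp only: inv_closed)
    then show False using \<chi> ab(2) character_one by simp
  qed
  moreover have "?ev ` carrier G \<subseteq> (\<Pi>\<^sub>E \<chi>\<in>characters G. {z. z ^ n \<chi> = 1})"
    unfolding image_subset_iff restrict_PiE_iff using n by blast
  moreover have "finite (\<Pi>\<^sub>E \<chi>\<in>characters G. {z::complex. z ^ n \<chi> = 1})"
    using n fin by (intro finite_PiE finite_roots_unity) (auto simp: Suc_le_eq)
  ultimately show ?thesis using finite_imageD finite_subset by blast
qed

text \<open>In the finite case, evaluate \<open>\<Sum>\<chi>. \<Sum>x. \<chi> x\<close> in both orders: only the trivial character contributes to the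
  one, only the unit element to the other. In the infinite case the set of characters is infinite as
  well, and both cardinalities are \<open>0\<close> by convention.\<close>

lemma (in comm_group) card_characters: "card (characters G) = card (carrier G)"
proof (cases "finite (carrier G)")
  case True
  let ?\<epsilon> = "\<lambda>x\<in>carrier G. 1 :: complex"
  have fin: "finite (characters G)" using finite_characters[OF True] .
  have triv: "\<chi> = ?\<epsilon>" if "\<chi> \<in> characters G" "\<forall>x\<in>carrier G. \<chi> x = 1" for \<chi>
    using that by (intro extensionalityI[of _ "carrier G"]) auto
  have triv_in: "?\<epsilon> \<in> characters G" using U.one_closed by (simp add: hom_def)
  have "of_nat (card (carrier G)) = (\<Sum>\<chi>\<in>characters G. if \<chi> = ?\<epsilon> then of_nat (card (carrier G)) else 0 :: complex)"
    using fin triv_in by (simp add: sum.delta)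
  also have "\<dots> = (\<Sum>\<chi>\<in>characters G. \<Sum>x\<in>carrier G. \<chi> x)"
  proof (rule sum.cong[OF refl])
    fix \<chi> assume \<chi>: "\<chi> \<in> characters G"
    have "\<chi> = ?\<epsilon> \<longleftrightarrow> (\<forall>x\<in>carrier G. \<chi> x = 1)" using triv[OF \<chi>] by auto
    then show "(if \<chi> = ?\<epsilon> then of_nat (card (carrier G)) else 0) = (\<Sum>x\<in>carrier G. \<chi> x)"
      using sum_character[OF \<chi> True] by simp
  qed
  also have "\<dots> = (\<Sum>x\<in>carrier G. \<Sum>\<chi>\<in>characters G. \<chi> x)" by (rule sum.swap)
  also have "\<dots> = (\<Sum>x\<in>carrier G. if x = \<one> then of_nat (card (characters G)) else 0)"
    by (intro sum.cong refl sum_over_characters fin)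
  also have "\<dots> = of_nat (card (characters G))" using True by (simp add: sum.delta)
  finally show ?thesis by (simp only: of_nat_eq_iff)
next
  case False
  then show ?thesis using finite_carrier_of_finite_characters by (metis card.infinite)
qed


section \<open>Homomorphisms to the rationals modulo one\<close>

lemma bij_betw_hom_iso:
  assumes "group A" "group D" and h: "h \<in> iso D E"
  shows "bij_betw (\<lambda>\<phi>. restrict (h \<circ> \<phi>) (carrier A))
    (hom A D \<inter> extensional (carrier A)) (hom A E \<inter> extensional (carrier A))"
proof (rule bij_betw_byWitness[where f' = "\<lambda>\<phi>. restrict (inv_into (carrier D) h \<circ> \<phi>) (carrier A)"])
  interpret A: group A by fact
  let ?h' = "inv_into (carrier D) h"
  have h': "?h' \<in> iso E D" using group.iso_set_sym[OF assms(2) h] .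
  have compat: "restrict (f \<circ> \<phi>) (carrier A) \<in> hom A C \<inter> extensional (carrier A)"
    if "\<phi> \<in> hom A B" "f \<in> hom B C"
    for f \<phi> and B :: "('x, 'y) monoid_scheme" and C :: "('z, 'w) monoid_scheme"
    using hom_compose[OF that] by (auto simp: hom_def)
  show "(\<lambda>\<phi>. restrict (h \<circ> \<phi>) (carrier A)) ` (hom A D \<inter> extensional (carrier A))
      \<subseteq> hom A E \<inter> extensional (carrier A)"
    using compat h by (auto simp: iso_def)
  show "(\<lambda>\<phi>. restrict (?h' \<circ> \<phi>) (carrier A)) ` (hom A E \<inter> extensional (carrier A))
      \<subseteq> hom A D \<inter> extensional (carrier A)"
    using compat h' by (auto simp: iso_def)
  have bij: "bij_betw h (carrier D) (carrier E)" using h by (simp add: iso_def)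
  show "\<forall>\<phi>\<in>hom A D \<inter> extensional (carrier A).
      restrict (?h' \<circ> restrict (h \<circ> \<phi>) (carrier A)) (carrier A) = \<phi>"
    using bij_betw_inv_into_left[OF bij] by (auto simp: hom_def Pi_iff intro!: extensionalityI[of _ "carrier A"])
  show "\<forall>\<phi>\<in>hom A E \<inter> extensional (carrier A).
      restrict (h \<circ> restrict (?h' \<circ> \<phi>) (carrier A)) (carrier A) = \<phi>"
    using bij_betw_inv_into_right[OF bij] by (auto simp: hom_def Pi_iff intro!: extensionalityI[of _ "carrier A"])
qed

lemma (in comm_group) card_hom_Q_mod_Z:
  "card (hom G Q_mod_Z \<inter> extensional (carrier G)) = card (carrier G)"
proof -
  obtain h where "h \<in> iso Q_mod_Z roots_of_unity"
    using Q_mod_Z_iso_roots_of_unity by (auto simp: is_iso_def)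
  then have "card (hom G Q_mod_Z \<inter> extensional (carrier G)) = card (characters G)"
    using bij_betw_hom_iso[OF is_group _ \<open>h \<in> _\<close>] comm_group_Q_mod_Z bij_betw_same_card
    by (meson comm_group.axioms(2))
  then show ?thesis by (simp add: card_characters)
qed

text \<open>A homomorphism on \<open>A\<close> that vanishes on the kernel of \<open>f\<close> is constant on the fibres of \<open>f\<close> and so descends to
  the quotient \<open>B\<close> of \<open>A\<close>.\<close>

lemma bij_betw_hom_factor:
  assumes f: "group_hom A B f" and surj: "f ` carrier A = carrier B" and D: "group D"
  shows "bij_betw (\<lambda>\<phi>. restrict (\<phi> \<circ> f) (carrier A))
    (hom B D \<inter> extensional (carrier B))
    {\<phi> \<in> hom A D \<inter> extensional (carrier A). \<forall>x\<in>kernel A B f. \<phi> x = \<one>\<^bsub>D\<^esub>}"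
  (is "bij_betw ?F ?HB ?HA")
proof -
  interpret f: group_hom A B f by fact
  interpret D: group D by fact
  have "inj_on ?F ?HB"
  proof (rule inj_onI)
    fix \<phi> \<psi> assume *: "\<phi> \<in> ?HB" "\<psi> \<in> ?HB" "?F \<phi> = ?F \<psi>"
    have "\<phi> y = \<psi> y" if y: "y \<in> carrier B" for y
    proof -
      obtain x where "x \<in> carrier A" "y = f x" using surj y by blast
      then show ?thesis using fun_cong[OF *(3), of x] by simp
    qed
    then show "\<phi> = \<psi>" using * by (intro extensionalityI[of _ "carrier B"]) auto
  qed
  moreover have "?F ` ?HB \<subseteq> ?HA"
  proof clarify
    fix \<phi> assume \<phi>: "\<phi> \<in> hom B D"
    have "\<phi> \<one>\<^bsub>B\<^esub> = \<one>\<^bsub>D\<^esub>" using hom_one[OF \<phi> f.H.is_group D] .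
    then show "?F \<phi> \<in> hom A D \<inter> extensional (carrier A) \<and> (\<forall>x\<in>kernel A B f. ?F \<phi> x = \<one>\<^bsub>D\<^esub>)"
      using hom_compose[OF f.homh \<phi>] by (auto simp: hom_def kernel_def)
  qed
  moreover have "?HA \<subseteq> ?F ` ?HB"
  proof
    fix \<phi> assume \<phi>: "\<phi> \<in> ?HA"
    interpret \<phi>: group_hom A D \<phi>
      using \<phi> by unfold_locales auto
    have well_def: "\<phi> x = \<phi> x'" if "x \<in> carrier A" "x' \<in> carrier A" "f x = f x'" for x x'
    proof -
      have "x \<otimes>\<^bsub>A\<^esub> inv\<^bsub>A\<^esub> x' \<in> kernel A B f" using that by (simp add: kernel_def)
      then have "\<phi> (x \<otimes>\<^bsub>A\<^esub> inv\<^bsub>A\<^esub> x') = \<one>\<^bsub>D\<^esub>" using \<phi> by simp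
      then have "\<phi> x \<otimes>\<^bsub>D\<^esub> inv\<^bsub>D\<^esub> \<phi> x' = \<one>\<^bsub>D\<^esub>" using that by simp
      then show ?thesis using that by (metis D.inv_closed D.inv_equality D.inv_inv \<phi>.hom_closed)
    qed
    define s where "s = inv_into (carrier A) f"
    have s: "s y \<in> carrier A" "f (s y) = y" if "y \<in> carrier B" for y
      using that surj by (auto simp: s_def inv_into_into f_inv_into_f)
    let ?\<psi> = "restrict (\<phi> \<circ> s) (carrier B)"
    have "?\<psi> \<in> hom B D"
    proof (rule homI)
      show "?\<psi> y \<in> carrier D" if "y \<in> carrier B" for y using s that by simp
      fix y y' assume y: "y \<in> carrier B" "y' \<in> carrier B"
      have "\<phi> (s (y \<otimes>\<^bsub>B\<^esub> y')) = \<phi> (s y \<otimes>\<^bsub>A\<^esub> s y')"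
        using y s by (intro well_def) auto
      then show "?\<psi> (y \<otimes>\<^bsub>B\<^esub> y') = ?\<psi> y \<otimes>\<^bsub>D\<^esub> ?\<psi> y'" using y s by simp
    qed
    moreover have "?F ?\<psi> = \<phi>"
    proof (rule extensionalityI[of _ "carrier A"])
      fix x assume "x \<in> carrier A"
      then show "?F ?\<psi> x = \<phi> x" using s well_def[of "s (f x)" x] by simp
    qed (use \<phi> in auto)
    ultimately show "\<phi> \<in> ?F ` ?HB" by (intro image_eqI[of _ _ ?\<psi>]) auto
  qed
  ultimately show ?thesis by (auto simp: bij_betw_def)
qed


section \<open>Homomorphisms from a free group\<close>

text \<open>The homomorphism with \<open>x\<^sub>g \<mapsto> s g\<close> that the universal property of the free group provides.\<close>

definition free_extension :: "('b, 'c) monoid_scheme \<Rightarrow> ('a \<Rightarrow> 'b) \<Rightarrow> 'a word \<Rightarrow> 'b"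
  where "free_extension E s w = word_val E (map (map_prod id s) w)"

context group
begin

text \<open>Reducing before or after the substitution makes no difference to the value, although the word that
  results from substitution in a reduced word need not be reduced.\<close>

lemma word_val_map_reduce:
  assumes s: "s \<in> S \<rightarrow> carrier G" and w: "w \<in> lists (UNIV \<times> S)"
  shows "word_val G (map (map_prod id s) (reduce w)) = word_val G (map (map_prod id s) w)"
  using w
proof (induction w rule: list.induct)
  case (Cons l w)
  let ?m = "map (map_prod id s)"
  have lists: "?m v \<in> lists (UNIV \<times> carrier G)" if "v \<in> lists (UNIV \<times> S)" for v
    using that s by (induction v) auto
  have step: "word_val G (?m (cancel_Cons l v)) = word_val G (?m (l # v))"
    if v: "v \<in> lists (UNIV \<times> S)" for v
  proof (cases "v \<noteq> [] \<and> hd v = inv_letter l")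
    case True
    then obtain v' where v': "v = inv_letter l # v'" by (cases v) auto
    have "cancel_Cons (map_prod id s l) (?m v) = ?m v'"
      by (simp add: v' inv_letter_def)
    moreover have "map_prod id s l \<in> UNIV \<times> carrier G" using Cons.prems s by auto
    ultimately show ?thesis
      using word_val_cancel_Cons[OF _ lists[OF v], of "map_prod id s l"] v' by simp
  next
    case False
    then have "cancel_Cons l v = l # v" by (cases v) auto
    then show ?thesis by simp
  qed
  have "word_val G (?m (reduce (l # w))) = word_val G (?m (l # reduce w))"
    using step[of "reduce w"] reduce_in_lists[of w S] Cons.prems by (simp add: reduce_def)
  also have "\<dots> = word_val G (?m (l # w))"
  proof -
    have "word_val G (?m (l # v)) = (if fst l then inv (s (snd l)) else s (snd l)) \<otimes> word_val G (?m v)" for v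
      by (simp add: word_val_def)
    moreover have "word_val G (?m (reduce w)) = word_val G (?m w)" using Cons.prems by (intro Cons.IH) simp
    ultimately show ?thesis by (simp only:)
  qed
  finally show ?case .
qed (simp add: reduce_def)

lemma free_extension_hom:
  assumes "s \<in> S \<rightarrow> carrier G"
  shows "group_hom (free_group S) G (free_extension G s)"
proof -
  have lists: "map (map_prod id s) v \<in> lists (UNIV \<times> carrier G)" if "v \<in> lists (UNIV \<times> S)" for v
    using that assms by (induction v) auto
  have "free_extension G s \<in> hom (free_group S) G"
  proof (rule homI)
    fix u v assume "u \<in> carrier (free_group S)" "v \<in> carrier (free_group S)"
    then have uv: "u \<in> lists (UNIV \<times> S)" "v \<in> lists (UNIV \<times> S)" by (simp_all add: carrier_free_group)
    then show "free_extension G s u \<in> carrier G"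
      unfolding free_extension_def by (intro word_val_closed lists)
    have "u @ v \<in> lists (UNIV \<times> S)" using uv by simp
    then show "free_extension G s (u \<otimes>\<^bsub>free_group S\<^esub> v) = free_extension G s u \<otimes> free_extension G s v"
      using word_val_append[OF lists[OF uv(1)] lists[OF uv(2)]] word_val_map_reduce[OF assms]
      by (simp add: free_extension_def mult_free_group)
  qed
  then show ?thesis
    using group_free_group is_group by (simp add: group_hom_def group_hom_axioms_def)
qed

lemma free_extension_gen: "s g \<in> carrier G \<Longrightarrow> free_extension G s (free_gen g) = s g"
  by (simp add: free_extension_def free_gen_def word_val_def)

end

lemma free_group_generated: "carrier (free_group S) = generate (free_group S) (free_gen ` S)"
proof
  interpret F: group "free_group S" by (rule group_free_group)
  have gens: "free_gen ` S \<subseteq> carrier (free_group S)" by (intro image_subsetI free_gen_in_carrier)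
  then show "generate (free_group S) (free_gen ` S) \<subseteq> carrier (free_group S)"
    by (rule F.generate_incl)
  show "carrier (free_group S) \<subseteq> generate (free_group S) (free_gen ` S)"
  proof
    fix w assume "w \<in> carrier (free_group S)"
    then show "w \<in> generate (free_group S) (free_gen ` S)"
    proof (induction w)
      case Nil
      show ?case using generate.one[of "free_group S"] by (simp add: one_free_group)
    next
      case (Cons l v)
      then have v: "v \<in> carrier (free_group S)" and l: "snd l \<in> S"
        by (auto simp: carrier_free_group dest: reduced_ConsD)
      have "[l] \<otimes>\<^bsub>free_group S\<^esub> v = l # v"
        using Cons.prems by (simp add: mult_free_group carrier_free_group reduce_reduced)
      moreover have "[l] \<in> generate (free_group S) (free_gen ` S)"
      proof (cases "fst l")
        case False
        then have "[l] = free_gen (snd l)" by (simp add: free_gen_def prod_eq_iff)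
        then show ?thesis using l by (auto intro: generate.incl)
      next
        case True
        then have l_eq: "l = (True, snd l)" by (simp add: prod_eq_iff)
        have "[(True, snd l)] \<otimes>\<^bsub>free_group S\<^esub> free_gen (snd l) = \<one>\<^bsub>free_group S\<^esub>"
          by (simp add: mult_free_group one_free_group free_gen_def reduce_def inv_letter_def)
        moreover have "[(True, snd l)] \<in> carrier (free_group S)"
          using l by (simp add: carrier_free_group)
        ultimately have "inv\<^bsub>free_group S\<^esub> (free_gen (snd l)) = [l]"
          using F.inv_equality[of "[(True, snd l)]"] free_gen_in_carrier[OF l] l_eq by simp
        then show ?thesis
          using generate.inv[of "free_gen (snd l)" "free_gen ` S" "free_group S"] l by simp
      qed
      ultimately show ?case using Cons.IH[OF v] generate.eng by metis
    qed
  qed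
qed

lemma free_group_induct [consumes 1, case_names one gen inv mult]:
  assumes w: "w \<in> carrier (free_group S)"
    and one: "P \<one>\<^bsub>free_group S\<^esub>"
    and gen: "\<And>g. g \<in> S \<Longrightarrow> P (free_gen g)"
    and inv: "\<And>g. g \<in> S \<Longrightarrow> P (inv\<^bsub>free_group S\<^esub> (free_gen g))"
    and mult: "\<And>u v. u \<in> carrier (free_group S) \<Longrightarrow> v \<in> carrier (free_group S) \<Longrightarrow> P u \<Longrightarrow> P v
      \<Longrightarrow> P (u \<otimes>\<^bsub>free_group S\<^esub> v)"
  shows "P w"
  using w unfolding free_group_generated
proof (induction w rule: generate.induct)
  case (eng u v)
  then show ?case using mult by (simp flip: free_group_generated)
qed (use one gen inv in auto)


section \<open>Conjugation in the cover\<close>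

context equipped_finite_group
begin

abbreviation (input) F where "F \<equiv> free_group \<O>"
abbreviation (input) val where "val \<equiv> word_val G"
abbreviation (input) R where "R \<equiv> relator_subgroup G \<O>"

lemma gen_closed [simp]: "g \<in> \<O> \<Longrightarrow> g \<in> carrier G" "g \<in> \<O> \<Longrightarrow> free_gen g \<in> carrier F"
  using O_subset free_gen_in_carrier by auto

lemma val_free_gen [simp]: "g \<in> \<O> \<Longrightarrow> val (free_gen g) = g"
  by (simp add: word_val_free_gen)

lemma mem_relator_subgroup: "r \<in> R \<longleftrightarrow> r \<in> carrier F \<and> val r = \<one>"
  by (auto simp: relator_subgroup_def kernel_def)

text \<open>The relations say that \<open>x\<^sub>h\<close> conjugates \<open>x\<^sub>g\<close> to the letter of the conjugate of \<open>g\<close> by \<open>h\<close>; as \<open>\<O>\<close> is closed under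
  conjugation, this persists for words in place of \<open>x\<^sub>h\<close>.\<close>

lemma cover_relations_conjugation:
  assumes "group_hom F E q" and rel: "relators \<subseteq> kernel F E q"
    and w: "w \<in> carrier F" and g: "g \<in> \<O>"
  shows "q w \<otimes>\<^bsub>E\<^esub> q (free_gen g) = q (free_gen (val w \<otimes> g \<otimes> inv (val w))) \<otimes>\<^bsub>E\<^esub> q w"
proof -
  interpret q: group_hom F E q by fact
  interpret v: group_hom F G val by (rule word_val_group_hom)
  have step: "q (free_gen h) \<otimes>\<^bsub>E\<^esub> q (free_gen g) = q (free_gen (h \<otimes> g \<otimes> inv h)) \<otimes>\<^bsub>E\<^esub> q (free_gen h)"
    if gh: "g \<in> \<O>" "h \<in> \<O>" for g h
  proof -
    let ?u = "free_gen h \<otimes>\<^bsub>F\<^esub> free_gen g" and ?v = "free_gen (h \<otimes> g \<otimes> inv h) \<otimes>\<^bsub>F\<^esub> free_gen h"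
    have c: "?u \<in> carrier F" "?v \<in> carrier F" using gh O_conj[of g h] by auto
    have "(?u, ?v) \<in> cover_relations G \<O>" using gh by (auto simp: cover_relations_def)
    then have "?u \<otimes>\<^bsub>F\<^esub> inv\<^bsub>F\<^esub> ?v \<in> kernel F E q" using rel by blast
    then have "q ?u \<otimes>\<^bsub>E\<^esub> inv\<^bsub>E\<^esub> q ?v = \<one>\<^bsub>E\<^esub>" using c by (simp add: kernel_def)
    then have "q ?u = q ?v"
      using c by (metis q.H.inv_closed q.H.inv_equality q.H.inv_inv q.hom_closed)
    then show ?thesis using gh O_conj[of g h] by simp
  qed
  show ?thesis
    using w g
  proof (induction arbitrary: g rule: free_group_induct)
    case one
    then show ?case by simp
  next
    case (gen h)
    then show ?case using step by simp
  next
    case (inv h)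
    let ?g' = "inv h \<otimes> g \<otimes> h"
    have g': "?g' \<in> \<O>" using inv O_conj_inv by simp
    have "h \<otimes> ?g' \<otimes> inv h = g" using inv by (simp add: m_assoc) (simp add: m_assoc[symmetric])
    then have "q (free_gen h) \<otimes>\<^bsub>E\<^esub> q (free_gen ?g') = q (free_gen g) \<otimes>\<^bsub>E\<^esub> q (free_gen h)"
      using step[OF g' inv(1)] by simp
    then have "inv\<^bsub>E\<^esub> q (free_gen h) \<otimes>\<^bsub>E\<^esub> q (free_gen g) = q (free_gen ?g') \<otimes>\<^bsub>E\<^esub> inv\<^bsub>E\<^esub> q (free_gen h)"
      using inv g' by (metis gen_closed(2) q.H.inv_closed q.H.inv_solve_left q.H.inv_solve_right q.H.m_assoc
          q.H.m_closed q.hom_closed)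
    then show ?case using inv by simp
  next
    case (mult u v)
    let ?g' = "val v \<otimes> g \<otimes> inv (val v)"
    have g': "?g' \<in> \<O>" using mult O_conj by simp
    have c: "val (u \<otimes>\<^bsub>F\<^esub> v) \<otimes> g \<otimes> inv (val (u \<otimes>\<^bsub>F\<^esub> v)) = val u \<otimes> ?g' \<otimes> inv (val u)"
      using mult by (simp add: m_assoc inv_mult_group)
    have g'': "val u \<otimes> ?g' \<otimes> inv (val u) \<in> \<O>" using O_conj[OF g'] mult by simp
    have u: "q u \<otimes>\<^bsub>E\<^esub> q (free_gen ?g') = q (free_gen (val u \<otimes> ?g' \<otimes> inv (val u))) \<otimes>\<^bsub>E\<^esub> q u"
      by (rule mult.IH(1)[OF g'])
    have v: "q v \<otimes>\<^bsub>E\<^esub> q (free_gen g) = q (free_gen ?g') \<otimes>\<^bsub>E\<^esub> q v"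
      by (rule mult.IH(2)[OF mult.prems])
    have "q (u \<otimes>\<^bsub>F\<^esub> v) \<otimes>\<^bsub>E\<^esub> q (free_gen g) = q u \<otimes>\<^bsub>E\<^esub> (q (free_gen ?g') \<otimes>\<^bsub>E\<^esub> q v)"
      using mult g' v by (simp add: q.H.m_assoc)
    also have "\<dots> = (q (free_gen (val u \<otimes> ?g' \<otimes> inv (val u))) \<otimes>\<^bsub>E\<^esub> q u) \<otimes>\<^bsub>E\<^esub> q v"
      using mult g' u by (simp add: q.H.m_assoc[symmetric])
    also have "\<dots> = q (free_gen (val u \<otimes> ?g' \<otimes> inv (val u))) \<otimes>\<^bsub>E\<^esub> q (u \<otimes>\<^bsub>F\<^esub> v)"
      using mult g'' by (simp add: q.H.m_assoc)
    finally show ?case using c by (simp only:)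
  qed
qed

text \<open>A word of trivial value commutes with all generators by \<open>cover_relations_conjugation\<close>, hence with
  everything.\<close>

lemma cover_relations_central:
  assumes q: "group_hom F E q" and rel: "relators \<subseteq> kernel F E q"
    and r: "r \<in> R" and w: "w \<in> carrier F"
  shows "q w \<otimes>\<^bsub>E\<^esub> q r = q r \<otimes>\<^bsub>E\<^esub> q w"
proof -
  interpret q: group_hom F E q by fact
  have rF: "r \<in> carrier F" "val r = \<one>" using r by (auto simp: mem_relator_subgroup)
  have comm: "q r \<otimes>\<^bsub>E\<^esub> q (free_gen g) = q (free_gen g) \<otimes>\<^bsub>E\<^esub> q r" if "g \<in> \<O>" for g
    using cover_relations_conjugation[OF q rel rF(1) that] that rF(2) by simp
  show ?thesis
    using w
  proof (induction rule: free_group_induct)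
    case one
    then show ?case using rF by simp
  next
    case (gen g)
    then show ?case using comm by simp
  next
    case (inv g)
    then show ?case
      using comm[of g] rF
      by (metis gen_closed(2) q.H.inv_closed q.H.inv_solve_left q.H.inv_solve_right q.H.m_assoc
          q.H.m_closed q.hom_closed q.hom_inv)
  next
    case (mult u v)
    then show ?case
      using rF by (metis q.H.m_assoc q.hom_closed q.hom_mult)
  qed
qed

end


section \<open>Lifts of the generators that are compatible with conjugation\<close>

lemma (in group) commutator_mult_central:
  assumes c: "a \<in> carrier G" "b \<in> carrier G" "y \<in> carrier G" "z \<in> carrier G"
    and y: "\<And>x. x \<in> {a, b, z} \<Longrightarrow> y \<otimes> x = x \<otimes> y"
    and z: "\<And>x. x \<in> {a, b} \<Longrightarrow> z \<otimes> x = x \<otimes> z"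
  shows "(y \<otimes> a) \<otimes> (z \<otimes> b) \<otimes> inv (y \<otimes> a) \<otimes> inv (z \<otimes> b) = a \<otimes> b \<otimes> inv a \<otimes> inv b"
proof -
  have "(y \<otimes> a) \<otimes> (z \<otimes> b) = (y \<otimes> z) \<otimes> (a \<otimes> b)"
    using c z[of a] by (metis insertCI m_assoc m_closed)
  moreover have "(z \<otimes> b) \<otimes> (y \<otimes> a) = (y \<otimes> z) \<otimes> (b \<otimes> a)"
    using c y[of b] y[of z] by (metis insertCI m_assoc m_closed)
  ultimately have "((y \<otimes> a) \<otimes> (z \<otimes> b)) \<otimes> inv ((z \<otimes> b) \<otimes> (y \<otimes> a))
      = ((y \<otimes> z) \<otimes> (a \<otimes> b)) \<otimes> inv ((y \<otimes> z) \<otimes> (b \<otimes> a))"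
    by simp
  also have "\<dots> = (y \<otimes> z) \<otimes> (a \<otimes> b \<otimes> inv a \<otimes> inv b) \<otimes> inv (y \<otimes> z)"
    using c by (simp add: inv_mult_group m_assoc)
  also have "\<dots> = a \<otimes> b \<otimes> inv a \<otimes> inv b"
  proof -
    let ?k = "a \<otimes> b \<otimes> inv a \<otimes> inv b"
    have cent: "y \<otimes> z \<otimes> x = x \<otimes> (y \<otimes> z)" if "x \<in> {a, b}" for x
      using that c y[of x] z[of x] by (metis insertE insertCI m_assoc singletonD)
    have inv_cent: "y \<otimes> z \<otimes> inv x = inv x \<otimes> (y \<otimes> z)" if x: "x \<in> {a, b}" for x
    proof -
      have xc: "x \<in> carrier G" using x c by auto
      then show ?thesis using cent[OF x] c(3,4)
        by (metis inv_closed inv_solve_left inv_solve_right m_assoc m_closed)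
    qed
    have "y \<otimes> z \<otimes> ?k = ?k \<otimes> (y \<otimes> z)"
    proof -
      have step: "y \<otimes> z \<otimes> (u \<otimes> v) = u \<otimes> v \<otimes> (y \<otimes> z)"
        if "u \<in> carrier G" "v \<in> carrier G" "y \<otimes> z \<otimes> u = u \<otimes> (y \<otimes> z)" "y \<otimes> z \<otimes> v = v \<otimes> (y \<otimes> z)" for u v
        using that c by (metis m_assoc m_closed)
      show ?thesis using c cent inv_cent by (intro step) auto
    qed
    then show ?thesis using c by (simp add: m_assoc)
  qed
  finally show ?thesis using c by (simp add: inv_mult_group m_assoc)
qed

context equipped_finite_group
begin

lemma relator_subgroup_group: "subgroup R F"
  using relator_subgroup_normal normal_imp_subgroup by blast

text \<open>In each conjugacy class fix \<open>rep g\<close>, and for each \<open>g\<close> a word \<open>c g\<close> whose value conjugates \<open>rep g\<close> to \<open>g\<close>. Then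
  \<open>s g\<close> is the image of the conjugate of the letter of \<open>rep g\<close> by \<open>c g\<close>. Two words that conjugate \<open>rep g\<close> to the same
  element differ by a word \<open>u\<close> whose value commutes with \<open>rep g\<close>, and the assumption on commutators says that
  such a \<open>u\<close> commutes with the letter of \<open>rep g\<close> after \<open>q\<close>; hence the compatibility with conjugation.\<close>

lemma equivariant_section:
  assumes q: "group_hom F E q"
    and comm: "\<And>w g. w \<in> carrier F \<Longrightarrow> g \<in> \<O> \<Longrightarrow> commutator F w (free_gen g) \<in> R
      \<Longrightarrow> q (commutator F w (free_gen g)) = \<one>\<^bsub>E\<^esub>"
  shows "\<exists>s. (\<forall>g\<in>\<O>. \<exists>r\<in>R. s g = q (r \<otimes>\<^bsub>F\<^esub> free_gen g)) \<and>
    (\<forall>w\<in>carrier F. \<forall>g\<in>\<O>. q w \<otimes>\<^bsub>E\<^esub> s g = s (val w \<otimes> g \<otimes> inv (val w)) \<otimes>\<^bsub>E\<^esub> q w)"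
proof -
  interpret q: group_hom F E q by fact
  interpret v: group_hom F G val by (rule word_val_group_hom)
  define rep where "rep g = (SOME r. r \<in> conj_class G g)" for g
  have rep: "rep g \<in> conj_class G g" if "g \<in> \<O>" for g
  proof -
    have "g \<in> conj_class G g"
      using that by (auto simp: conj_class_def intro!: exI[of _ \<one>])
    then show ?thesis unfolding rep_def by (rule someI)
  qed
  have rep_O: "rep g \<in> \<O>" if "g \<in> \<O>" for g
    using rep[OF that] O_conj[OF that] by (auto simp: conj_class_def)
  have "\<exists>c\<in>carrier F. val c \<otimes> rep g \<otimes> inv (val c) = g" if g: "g \<in> \<O>" for g
  proof -
    obtain h where h: "h \<in> carrier G" "rep g = h \<otimes> g \<otimes> inv h"
      using rep[OF g] by (auto simp: conj_class_def)
    obtain c where c: "c \<in> carrier F" "val c = inv h"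
      using word_val_surj h by (metis imageE inv_closed)
    have "inv h \<otimes> rep g \<otimes> inv (inv h) = g"
      using h(1) g unfolding h(2) by (simp add: m_assoc) (simp add: m_assoc[symmetric])
    then show ?thesis using c by (intro bexI[of _ c]) simp_all
  qed
  then obtain c where c: "\<And>g. g \<in> \<O> \<Longrightarrow> c g \<in> carrier F"
    "\<And>g. g \<in> \<O> \<Longrightarrow> val (c g) \<otimes> rep g \<otimes> inv (val (c g)) = g"
    by metis
  have rep_conj: "rep (h \<otimes> g \<otimes> inv h) = rep g" if g: "g \<in> \<O>" and h: "h \<in> carrier G" for g h
  proof -
    have "conj_class G (h \<otimes> g \<otimes> inv h) = conj_class G g"
    proof
      show "conj_class G (h \<otimes> g \<otimes> inv h) \<subseteq> conj_class G g"
      proof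
        fix x assume "x \<in> conj_class G (h \<otimes> g \<otimes> inv h)"
        then obtain k where k: "k \<in> carrier G" "x = k \<otimes> (h \<otimes> g \<otimes> inv h) \<otimes> inv k"
          by (auto simp: conj_class_def)
        then have "x = (k \<otimes> h) \<otimes> g \<otimes> inv (k \<otimes> h)"
          using g h by (simp add: m_assoc inv_mult_group)
        then show "x \<in> conj_class G g" using k(1) h unfolding conj_class_def by blast
      qed
      show "conj_class G g \<subseteq> conj_class G (h \<otimes> g \<otimes> inv h)"
      proof
        fix x assume "x \<in> conj_class G g"
        then obtain k where k: "k \<in> carrier G" "x = k \<otimes> g \<otimes> inv k"
          by (auto simp: conj_class_def)
        have cancel: "inv h \<otimes> (h \<otimes> z) = z" if "z \<in> carrier G" for z
          using h that by (simp add: m_assoc[symmetric])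
        have "x = (k \<otimes> inv h) \<otimes> (h \<otimes> g \<otimes> inv h) \<otimes> inv (k \<otimes> inv h)"
          using g h k by (simp add: m_assoc inv_mult_group cancel)
        then show "x \<in> conj_class G (h \<otimes> g \<otimes> inv h)"
          using k(1) h unfolding conj_class_def by blast
      qed
    qed
    then show ?thesis by (simp add: rep_def)
  qed
  define lift where "lift g = c g \<otimes>\<^bsub>F\<^esub> free_gen (rep g) \<otimes>\<^bsub>F\<^esub> inv\<^bsub>F\<^esub> (c g)" for g
  have lift: "lift g \<in> carrier F" "val (lift g) = g" if "g \<in> \<O>" for g
    using that c[OF that] rep_O[OF that] by (simp_all add: lift_def)
  show ?thesis
  proof (intro exI[of _ "\<lambda>g. q (lift g)"] conjI ballI)
    fix g assume g: "g \<in> \<O>"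
    have "lift g \<otimes>\<^bsub>F\<^esub> inv\<^bsub>F\<^esub> (free_gen g) \<in> R"
      using g lift[OF g] by (simp add: mem_relator_subgroup)
    moreover have "lift g = (lift g \<otimes>\<^bsub>F\<^esub> inv\<^bsub>F\<^esub> (free_gen g)) \<otimes>\<^bsub>F\<^esub> free_gen g"
      using g lift[OF g] by (simp add: q.G.m_assoc)
    ultimately show "\<exists>r\<in>R. q (lift g) = q (r \<otimes>\<^bsub>F\<^esub> free_gen g)" by metis
  next
    fix w g assume w: "w \<in> carrier F" and g: "g \<in> \<O>"
    define g' where "g' = val w \<otimes> g \<otimes> inv (val w)"
    define x where "x = free_gen (rep g)"
    have g': "g' \<in> \<O>" using g w O_conj by (simp add: g'_def)
    have rep': "rep g' = rep g" using rep_conj g w by (simp add: g'_def)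
    have x: "x \<in> carrier F" "val x = rep g" using rep_O[OF g] by (simp_all add: x_def)
    \<comment> \<open>Both \<open>w \<otimes> c g\<close> and \<open>c g'\<close> conjugate \<open>rep g\<close> to \<open>g'\<close>; \<open>u\<close> is their difference.\<close>
    define u where "u = inv\<^bsub>F\<^esub> (c g') \<otimes>\<^bsub>F\<^esub> w \<otimes>\<^bsub>F\<^esub> c g"
    note closed = w c(1)[OF g] c(1)[OF g'] x(1)
    have u: "u \<in> carrier F" using closed by (simp add: u_def)
    have wc: "w \<otimes>\<^bsub>F\<^esub> c g = c g' \<otimes>\<^bsub>F\<^esub> u"
      using closed by (simp add: u_def q.G.m_assoc[symmetric])
    have "val (u \<otimes>\<^bsub>F\<^esub> x) = val (x \<otimes>\<^bsub>F\<^esub> u)"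
    proof -
      have cg: "val (c g) \<otimes> rep g = g \<otimes> val (c g)"
        using c[OF g] g rep_O[OF g] by (metis gen_closed(1) inv_closed inv_solve_right' m_closed v.hom_closed)
      have cg': "val (c g') \<otimes> rep g = g' \<otimes> val (c g')"
        using c[OF g'] g' rep_O[OF g'] unfolding rep'
        by (metis gen_closed(1) inv_closed inv_solve_right' m_closed v.hom_closed)
      have wg: "g' \<otimes> val w = val w \<otimes> g"
        using g w by (simp add: g'_def m_assoc)
      have "val (c g') \<otimes> val (u \<otimes>\<^bsub>F\<^esub> x) = val (c g' \<otimes>\<^bsub>F\<^esub> u) \<otimes> rep g"
        using closed u x rep_O[OF g] by (simp add: m_assoc)
      also have "\<dots> = val w \<otimes> (val (c g) \<otimes> rep g)"
        using closed rep_O[OF g] by (simp add: wc[symmetric] m_assoc)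
      also have "\<dots> = g' \<otimes> val (w \<otimes>\<^bsub>F\<^esub> c g)"
        using closed g g' cg wg by (simp add: m_assoc[symmetric])
      also have "\<dots> = val (c g') \<otimes> val (x \<otimes>\<^bsub>F\<^esub> u)"
        using closed u x g' cg' rep_O[OF g] by (simp add: wc m_assoc[symmetric])
      finally show ?thesis using closed u by (simp only: l_cancel v.hom_closed q.G.m_closed)
    qed
    then have "commutator F u x \<in> R"
      using closed u rep_O[OF g] x(2)
      by (simp add: commutator_def mem_relator_subgroup m_assoc inv_mult_group[symmetric])
    then have "q (commutator F u x) = \<one>\<^bsub>E\<^esub>"
      using comm[OF u rep_O[OF g]] by (simp add: x_def)
    then have "q (u \<otimes>\<^bsub>F\<^esub> x) \<otimes>\<^bsub>E\<^esub> inv\<^bsub>E\<^esub> q (x \<otimes>\<^bsub>F\<^esub> u) = \<one>\<^bsub>E\<^esub>"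
      using closed u by (simp add: commutator_def q.H.inv_mult_group q.H.m_assoc)
    then have ux: "q (u \<otimes>\<^bsub>F\<^esub> x) = q (x \<otimes>\<^bsub>F\<^esub> u)"
      using closed u by (metis q.G.m_closed q.H.inv_closed q.H.inv_equality q.H.inv_inv q.hom_closed)
    have "q w \<otimes>\<^bsub>E\<^esub> q (lift g) = q ((w \<otimes>\<^bsub>F\<^esub> c g) \<otimes>\<^bsub>F\<^esub> x \<otimes>\<^bsub>F\<^esub> inv\<^bsub>F\<^esub> (c g))"
      using closed by (simp add: lift_def x_def[symmetric] q.H.m_assoc)
    also have "\<dots> = q (c g') \<otimes>\<^bsub>E\<^esub> q (u \<otimes>\<^bsub>F\<^esub> x) \<otimes>\<^bsub>E\<^esub> q (inv\<^bsub>F\<^esub> (c g))"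
      using closed u unfolding wc by (simp add: q.H.m_assoc)
    also have "\<dots> = q (c g' \<otimes>\<^bsub>F\<^esub> x \<otimes>\<^bsub>F\<^esub> u \<otimes>\<^bsub>F\<^esub> inv\<^bsub>F\<^esub> (c g))"
      using closed u unfolding ux by (simp add: q.H.m_assoc)
    also have "c g' \<otimes>\<^bsub>F\<^esub> x \<otimes>\<^bsub>F\<^esub> u \<otimes>\<^bsub>F\<^esub> inv\<^bsub>F\<^esub> (c g) = lift g' \<otimes>\<^bsub>F\<^esub> w"
    proof -
      have "u \<otimes>\<^bsub>F\<^esub> inv\<^bsub>F\<^esub> (c g) = inv\<^bsub>F\<^esub> (c g') \<otimes>\<^bsub>F\<^esub> w"
        using closed by (simp add: u_def q.G.m_assoc)
      then show ?thesis using closed u by (simp add: lift_def rep' x_def[symmetric] q.G.m_assoc)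
    qed
    also have "q (lift g' \<otimes>\<^bsub>F\<^esub> w) = q (lift g') \<otimes>\<^bsub>E\<^esub> q w"
      using lift[OF g'] w by simp
    finally show "q w \<otimes>\<^bsub>E\<^esub> q (lift g) = q (lift (val w \<otimes> g \<otimes> inv (val w))) \<otimes>\<^bsub>E\<^esub> q w"
      by (simp only: g'_def)
  qed
qed

text \<open>Use the homomorphism \<open>\<psi>\<close> that sends the letter of \<open>g\<close> to \<open>s g\<close> for a lift \<open>s\<close> as in
  \<open>equivariant_section\<close>. It respects the relations of the cover, because \<open>s\<close> is compatible with
  conjugation; so \<open>\<psi> w = 1\<close> if \<open>w\<close> follows from the relations. On the other hand \<open>\<psi>\<close> and \<open>q\<close> differ by factors
  that are central in the image of \<open>q\<close>, which cancel in commutators; so \<open>\<psi> w = q w\<close> if \<open>w\<close> is a product of commutators.\<close>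

lemma trivial_on_relations_in_derived:
  assumes q: "group_hom F E q"
    and central: "\<And>r w. r \<in> R \<Longrightarrow> w \<in> carrier F \<Longrightarrow> q r \<otimes>\<^bsub>E\<^esub> q w = q w \<otimes>\<^bsub>E\<^esub> q r"
    and comm: "\<And>w g. w \<in> carrier F \<Longrightarrow> g \<in> \<O> \<Longrightarrow> commutator F w (free_gen g) \<in> R
      \<Longrightarrow> q (commutator F w (free_gen g)) = \<one>\<^bsub>E\<^esub>"
    and w: "w \<in> normal_closure F relators" "w \<in> derived F (carrier F)"
  shows "q w = \<one>\<^bsub>E\<^esub>"
proof -
  interpret q: group_hom F E q by fact
  interpret R: subgroup R F by (rule relator_subgroup_group)
  interpret v: group_hom F G val by (rule word_val_group_hom)
  obtain s where s: "\<And>g. g \<in> \<O> \<Longrightarrow> \<exists>r\<in>R. s g = q (r \<otimes>\<^bsub>F\<^esub> free_gen g)"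
    and equivariant: "\<And>w g. w \<in> carrier F \<Longrightarrow> g \<in> \<O> \<Longrightarrow>
      q w \<otimes>\<^bsub>E\<^esub> s g = s (val w \<otimes> g \<otimes> inv (val w)) \<otimes>\<^bsub>E\<^esub> q w"
    using equivariant_section[OF q comm] by blast
  have RF: "r \<in> carrier F" if "r \<in> R" for r using that R.subset by blast
  have s_closed: "s g \<in> carrier E" if "g \<in> \<O>" for g
    using s[OF that] RF that by fastforce
  define \<psi> where "\<psi> = free_extension E s"
  interpret \<psi>: group_hom F E \<psi>
    unfolding \<psi>_def by (rule q.H.free_extension_hom) (use s_closed in auto)
  have \<psi>_gen: "\<psi> (free_gen g) = s g" if "g \<in> \<O>" for g
    unfolding \<psi>_def by (rule q.H.free_extension_gen) (rule s_closed[OF that])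

  have twist: "\<exists>r\<in>R. \<psi> u = q (r \<otimes>\<^bsub>F\<^esub> u)" if "u \<in> carrier F" for u
    using that
  proof (induction rule: free_group_induct)
    case one
    then show ?case using R.one_closed by (intro bexI[of _ "\<one>\<^bsub>F\<^esub>"]) simp_all
  next
    case (gen g)
    then show ?case using s \<psi>_gen by simp
  next
    case (inv g)
    obtain r where r: "r \<in> R" "s g = q (r \<otimes>\<^bsub>F\<^esub> free_gen g)" using s[OF inv] by blast
    have "\<psi> (inv\<^bsub>F\<^esub> free_gen g) = q (inv\<^bsub>F\<^esub> free_gen g) \<otimes>\<^bsub>E\<^esub> q (inv\<^bsub>F\<^esub> r)"
      using inv r RF[OF r(1)] \<psi>_gen by (simp add: q.H.inv_mult_group)
    also have "\<dots> = q (inv\<^bsub>F\<^esub> r \<otimes>\<^bsub>F\<^esub> inv\<^bsub>F\<^esub> free_gen g)"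
      using central[of "inv\<^bsub>F\<^esub> r" "inv\<^bsub>F\<^esub> free_gen g"] inv r RF[OF r(1)] by simp
    finally show ?case using r(1) R.m_inv_closed by blast
  next
    case (mult u v)
    then obtain r r' where r: "r \<in> R" "\<psi> u = q (r \<otimes>\<^bsub>F\<^esub> u)" and r': "r' \<in> R" "\<psi> v = q (r' \<otimes>\<^bsub>F\<^esub> v)"
      by blast
    have c: "r \<in> carrier F" "r' \<in> carrier F" using r r' RF by auto
    have "\<psi> (u \<otimes>\<^bsub>F\<^esub> v) = q r \<otimes>\<^bsub>E\<^esub> (q u \<otimes>\<^bsub>E\<^esub> q r') \<otimes>\<^bsub>E\<^esub> q v"
      using mult r r' c by (simp add: q.H.m_assoc)
    also have "\<dots> = q ((r \<otimes>\<^bsub>F\<^esub> r') \<otimes>\<^bsub>F\<^esub> (u \<otimes>\<^bsub>F\<^esub> v))"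
      unfolding central[OF r'(1) mult(1), symmetric] using mult c by (simp add: q.H.m_assoc)
    finally show ?case using r(1) r'(1) R.m_closed by blast
  qed

  have relators_ker: "relators \<subseteq> kernel F E \<psi>"
  proof
    fix z assume "z \<in> relators"
    then obtain u v where z: "z = u \<otimes>\<^bsub>F\<^esub> inv\<^bsub>F\<^esub> v" "(u, v) \<in> cover_relations G \<O>" by blast
    \<comment> \<open>Equivariance for a word that \<open>q\<close> maps to \<open>s g\<close>; its value is \<open>g\<close>.\<close>
    have conj: "s g \<otimes>\<^bsub>E\<^esub> s h = s (g \<otimes> h \<otimes> inv g) \<otimes>\<^bsub>E\<^esub> s g" if gh: "g \<in> \<O>" "h \<in> \<O>" for g h
    proof -
      obtain r where r: "r \<in> R" "s g = q (r \<otimes>\<^bsub>F\<^esub> free_gen g)" using s[OF gh(1)] by blast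
      have "val (r \<otimes>\<^bsub>F\<^esub> free_gen g) = g" "r \<otimes>\<^bsub>F\<^esub> free_gen g \<in> carrier F"
        using r(1) gh(1) by (simp_all add: mem_relator_subgroup)
      then show ?thesis using equivariant[of "r \<otimes>\<^bsub>F\<^esub> free_gen g" h] gh r by simp
    qed
    have "u \<in> carrier F \<and> v \<in> carrier F \<and> \<psi> u = \<psi> v"
      using z(2)
    proof (unfold cover_relations_def, elim UnE CollectE exE conjE)
      fix g h assume *: "(u, v) = (free_gen g \<otimes>\<^bsub>F\<^esub> free_gen h,
        free_gen h \<otimes>\<^bsub>F\<^esub> free_gen (inv h \<otimes> g \<otimes> h))" "g \<in> \<O>" "h \<in> \<O>"
      let ?g' = "inv h \<otimes> g \<otimes> h"
      have g': "?g' \<in> \<O>" using * O_conj_inv by simp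
      have "h \<otimes> ?g' \<otimes> inv h = g"
        using * by (simp add: m_assoc) (simp add: m_assoc[symmetric])
      then have "s h \<otimes>\<^bsub>E\<^esub> s ?g' = s g \<otimes>\<^bsub>E\<^esub> s h" using conj[OF *(3) g'] by simp
      then show ?thesis using * g' \<psi>_gen by simp
    next
      fix g h assume *: "(u, v) = (free_gen g \<otimes>\<^bsub>F\<^esub> free_gen h,
        free_gen (g \<otimes> h \<otimes> inv g) \<otimes>\<^bsub>F\<^esub> free_gen g)" "g \<in> \<O>" "h \<in> \<O>"
      then have "g \<otimes> h \<otimes> inv g \<in> \<O>" using O_conj by simp
      then show ?thesis using * conj \<psi>_gen by simp
    qed
    then show "z \<in> kernel F E \<psi>" using z(1) by (simp add: kernel_def)
  qed
  then have "\<psi> w = \<one>\<^bsub>E\<^esub>"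
    using w(1) group.normal_closure_subset[OF group_free_group relators_ker \<psi>.normal_kernel]
    by (auto simp: kernel_def)

  moreover have "\<psi> w = q w"
  proof -
    have comm_eq: "k \<in> carrier F \<and> \<psi> k = q k"
      if k: "k \<in> (\<Union>a\<in>carrier F. \<Union>b\<in>carrier F. {a \<otimes>\<^bsub>F\<^esub> b \<otimes>\<^bsub>F\<^esub> inv\<^bsub>F\<^esub> a \<otimes>\<^bsub>F\<^esub> inv\<^bsub>F\<^esub> b})" for k
    proof -
      obtain a b where ab: "k = a \<otimes>\<^bsub>F\<^esub> b \<otimes>\<^bsub>F\<^esub> inv\<^bsub>F\<^esub> a \<otimes>\<^bsub>F\<^esub> inv\<^bsub>F\<^esub> b" "a \<in> carrier F" "b \<in> carrier F"
        using k by blast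
      obtain r r' where r: "r \<in> R" "\<psi> a = q (r \<otimes>\<^bsub>F\<^esub> a)" and r': "r' \<in> R" "\<psi> b = q (r' \<otimes>\<^bsub>F\<^esub> b)"
        using twist ab by meson
      have c: "r \<in> carrier F" "r' \<in> carrier F" using r r' RF by auto
      have "q r \<otimes>\<^bsub>E\<^esub> x = x \<otimes>\<^bsub>E\<^esub> q r" if "x \<in> {q a, q b, q r'}" for x
        using that central[OF r(1)] ab c by auto
      moreover have "q r' \<otimes>\<^bsub>E\<^esub> x = x \<otimes>\<^bsub>E\<^esub> q r'" if "x \<in> {q a, q b}" for x
        using that central[OF r'(1)] ab c by auto
      ultimately have "(q r \<otimes>\<^bsub>E\<^esub> q a) \<otimes>\<^bsub>E\<^esub> (q r' \<otimes>\<^bsub>E\<^esub> q b) \<otimes>\<^bsub>E\<^esub> inv\<^bsub>E\<^esub> (q r \<otimes>\<^bsub>E\<^esub> q a) \<otimes>\<^bsub>E\<^esub> inv\<^bsub>E\<^esub> (q r' \<otimes>\<^bsub>E\<^esub> q b)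
          = q a \<otimes>\<^bsub>E\<^esub> q b \<otimes>\<^bsub>E\<^esub> inv\<^bsub>E\<^esub> q a \<otimes>\<^bsub>E\<^esub> inv\<^bsub>E\<^esub> q b"
        using ab c by (intro q.H.commutator_mult_central) auto
      then show ?thesis using ab c r(2) r'(2) by simp
    qed
    have "w \<in> carrier F \<and> \<psi> w = q w"
      using w(2) unfolding derived_def
    proof (induction rule: generate.induct)
      case one
      then show ?case by simp
    next
      case (incl k)
      then show ?case by (rule comm_eq)
    next
      case (inv k)
      then show ?case using comm_eq[of k] by simp
    next
      case (eng k l)
      then show ?case by simp
    qed
    then show ?thesis by blast
  qed
  ultimately show ?thesis by simp
qed

end


section \<open>From Hopf's formula to the cover\<close>

lemma (in normal) r_coset_group_hom: "group_hom G (G Mod H) (\<lambda>a. H #> a)"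
  using r_coset_hom_Mod factorgroup_is_group is_group
  by (simp add: group_hom_def group_hom_axioms_def)

lemma (in normal) r_coset_eq_one_iff:
  "a \<in> carrier G \<Longrightarrow> H #> a = \<one>\<^bsub>G Mod H\<^esub> \<longleftrightarrow> a \<in> H"
  using coset_join1[of H a] coset_join2[of a H] subgroup_axioms subset by auto

context equipped_finite_group
begin

abbreviation (input) N where "N \<equiv> normal_closure F relators"
abbreviation (input) M where "M \<equiv> R \<inter> derived F (carrier F)"
abbreviation (input) Z where "Z \<equiv> hopf_denominator G \<O>"

text \<open>The preimage of \<open>K\<close> in the free group, called \<open>L\<close> above; by \<open>K_words_normal\<close> below one may pass to the
  quotient \<open>F/L\<close>.\<close>

definition K_words :: "'a word set"
  where "K_words = generate F
    ({commutator F a r | a r. a \<in> carrier F \<and> r \<in> R} \<union>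
     {commutator F w (free_gen g) | w g. w \<in> carrier F \<and> g \<in> \<O> \<and> commutator F w (free_gen g) \<in> R})"

lemma commutator_closed:
  "a \<in> carrier F \<Longrightarrow> b \<in> carrier F \<Longrightarrow> commutator F a b \<in> carrier F"
proof -
  interpret F: group F by (rule group_free_group)
  show "a \<in> carrier F \<Longrightarrow> b \<in> carrier F \<Longrightarrow> commutator F a b \<in> carrier F"
    by (simp add: commutator_def)
qed

lemma commutator_in_derived:
  "a \<in> carrier F \<Longrightarrow> b \<in> carrier F \<Longrightarrow> commutator F a b \<in> derived F (carrier F)"
  unfolding derived_def commutator_def by (intro generate.incl) blast

lemma commutator_relator:
  assumes "a \<in> carrier F" "r \<in> R"
  shows "commutator F a r \<in> M"
proof -
  interpret R: normal R F by (rule relator_subgroup_normal)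
  have "a \<otimes>\<^bsub>F\<^esub> r \<otimes>\<^bsub>F\<^esub> inv\<^bsub>F\<^esub> a \<otimes>\<^bsub>F\<^esub> inv\<^bsub>F\<^esub> r \<in> R"
    using assms R.inv_op_closed2 by blast
  then show ?thesis using assms R.subset commutator_in_derived by (auto simp: commutator_def)
qed

text \<open>Any subgroup between \<open>[F, R]\<close> and \<open>R\<close> is normal, as \<open>F\<close> acts trivially on \<open>R/[F, R]\<close>.\<close>

lemma K_words_normal: "K_words \<lhd> F"
proof -
  interpret F: group F by (rule group_free_group)
  interpret R: subgroup R F by (rule relator_subgroup_group)
  have gens: "{commutator F a r | a r. a \<in> carrier F \<and> r \<in> R} \<union>
     {commutator F w (free_gen g) | w g. w \<in> carrier F \<and> g \<in> \<O> \<and> commutator F w (free_gen g) \<in> R} \<subseteq> R"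
    using commutator_relator by auto
  have sub: "subgroup K_words F"
    unfolding K_words_def using gens R.subset by (intro F.generate_is_subgroup) blast
  have le: "K_words \<subseteq> R"
    unfolding K_words_def using gens R.subgroup_axioms by (rule F.generate_subgroup_incl)
  have "x \<otimes>\<^bsub>F\<^esub> k \<otimes>\<^bsub>F\<^esub> inv\<^bsub>F\<^esub> x \<in> K_words"
    if x: "x \<in> carrier F" and k: "k \<in> K_words" for x k
  proof -
    have "k \<in> R" using k le by blast
    then have "commutator F x k \<in> K_words"
      unfolding K_words_def using x by (intro generate.incl) blast
    then have "commutator F x k \<otimes>\<^bsub>F\<^esub> k \<in> K_words"
      using k subgroup.m_closed[OF sub] by blast
    then show ?thesis
      using x \<open>k \<in> R\<close> R.subset by (auto simp: commutator_def F.m_assoc)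
  qed
  then show ?thesis using sub by (simp add: F.normal_inv_iff)
qed

lemma cover_projection: "group_hom F (cover_group G \<O>) (\<lambda>w. N #>\<^bsub>F\<^esub> w)"
  unfolding cover_group_def presented_group_def
  by (rule normal.r_coset_group_hom[OF normal_closure_relators_normal])

lemma cover_projection_eq_one_iff:
  "w \<in> carrier F \<Longrightarrow> N #>\<^bsub>F\<^esub> w = \<one>\<^bsub>cover_group G \<O>\<^esub> \<longleftrightarrow> w \<in> N"
  unfolding cover_group_def presented_group_def
  by (rule normal.r_coset_eq_one_iff[OF normal_closure_relators_normal])

lemma relators_subset_kernel_projection:
  "relators \<subseteq> kernel F (cover_group G \<O>) (\<lambda>w. N #>\<^bsub>F\<^esub> w)"
proof
  fix z assume z: "z \<in> relators"
  then have "z \<in> carrier F" using relators_subset_kernel by (auto simp: kernel_def)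
  moreover have "z \<in> N" using z by (auto simp: normal_closure_def)
  ultimately show "z \<in> kernel F (cover_group G \<O>) (\<lambda>w. N #>\<^bsub>F\<^esub> w)"
    using cover_projection_eq_one_iff by (simp add: kernel_def)
qed

lemmas cover_conjugation =
  cover_relations_conjugation[OF cover_projection relators_subset_kernel_projection]
lemmas cover_central =
  cover_relations_central[OF cover_projection relators_subset_kernel_projection]

text \<open>Elements of \<open>R\<close> are central in the cover.\<close>

lemma commutator_relator_in_N:
  assumes "a \<in> carrier F" "r \<in> R"
  shows "commutator F a r \<in> N"
proof -
  interpret p: group_hom F "cover_group G \<O>" "\<lambda>w. N #>\<^bsub>F\<^esub> w" by (rule cover_projection)
  have r: "r \<in> carrier F" using assms by (simp add: mem_relator_subgroup)
  have "N #>\<^bsub>F\<^esub> commutator F a r = \<one>\<^bsub>cover_group G \<O>\<^esub>"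
    using assms r cover_central[OF assms(2,1)]
    by (simp add: commutator_def p.H.m_assoc[symmetric] del: mult_FactGroup) (simp add: p.H.m_assoc)
  then show ?thesis using cover_projection_eq_one_iff commutator_closed assms r by blast
qed

text \<open>As the commutator has trivial value, \<open>g\<close> commutes with the value of \<open>w\<close>, so that \<open>y\<^sub>g\<close> is its own conjugate by
  \<open>w\<close> in the cover.\<close>

lemma commutator_gen_in_N:
  assumes w: "w \<in> carrier F" and g: "g \<in> \<O>" and R: "commutator F w (free_gen g) \<in> R"
  shows "commutator F w (free_gen g) \<in> N"
proof -
  interpret p: group_hom F "cover_group G \<O>" "\<lambda>w. N #>\<^bsub>F\<^esub> w" by (rule cover_projection)
  interpret v: group_hom F G val by (rule word_val_group_hom)
  have "val w \<otimes> g \<otimes> inv (val w) \<otimes> inv g = \<one>"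
    using R w g by (simp add: mem_relator_subgroup commutator_def)
  then have "val w \<otimes> g \<otimes> inv (val w) = g"
    using w g by (metis gen_closed(1) inv_closed inv_equality inv_inv m_closed v.hom_closed)
  then have "N #>\<^bsub>F\<^esub> commutator F w (free_gen g) = \<one>\<^bsub>cover_group G \<O>\<^esub>"
    using w g cover_conjugation[OF w g]
    by (simp add: commutator_def) (simp add: p.H.m_assoc)
  then show ?thesis using cover_projection_eq_one_iff commutator_closed w g by simp
qed

text \<open>The case \<open>E = F/L\<close> of \<open>trivial_on_relations_in_derived\<close>.\<close>

lemma N_Int_derived: "w \<in> N \<Longrightarrow> w \<in> derived F (carrier F) \<Longrightarrow> w \<in> K_words"
proof -
  assume w: "w \<in> N" "w \<in> derived F (carrier F)"
  interpret K: normal K_words F by (rule K_words_normal)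
  interpret q: group_hom F "F Mod K_words" "\<lambda>w. K_words #>\<^bsub>F\<^esub> w"
    by (rule K.r_coset_group_hom)
  have "K_words #>\<^bsub>F\<^esub> w = \<one>\<^bsub>F Mod K_words\<^esub>"
  proof (rule trivial_on_relations_in_derived[OF q.group_hom_axioms _ _ w])
    fix r v assume r: "r \<in> R" and v: "v \<in> carrier F"
    have rF: "r \<in> carrier F" using r by (simp add: mem_relator_subgroup)
    have "commutator F v r \<in> K_words"
      unfolding K_words_def using r v by (intro generate.incl) blast
    then have "v \<otimes>\<^bsub>F\<^esub> r \<otimes>\<^bsub>F\<^esub> inv\<^bsub>F\<^esub> (r \<otimes>\<^bsub>F\<^esub> v) \<in> K_words"
      using rF v by (simp add: commutator_def K.inv_mult_group K.m_assoc)
    then have "K_words #>\<^bsub>F\<^esub> (v \<otimes>\<^bsub>F\<^esub> r \<otimes>\<^bsub>F\<^esub> inv\<^bsub>F\<^esub> (r \<otimes>\<^bsub>F\<^esub> v)) = \<one>\<^bsub>F Mod K_words\<^esub>"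
      using K.r_coset_eq_one_iff K.subset by blast
    then have "(K_words #>\<^bsub>F\<^esub> (v \<otimes>\<^bsub>F\<^esub> r)) \<otimes>\<^bsub>F Mod K_words\<^esub>
        inv\<^bsub>F Mod K_words\<^esub> (K_words #>\<^bsub>F\<^esub> (r \<otimes>\<^bsub>F\<^esub> v)) = \<one>\<^bsub>F Mod K_words\<^esub>"
      using rF v by (metis K.inv_closed K.m_closed q.hom_inv q.hom_mult)
    then have "K_words #>\<^bsub>F\<^esub> (v \<otimes>\<^bsub>F\<^esub> r) = K_words #>\<^bsub>F\<^esub> (r \<otimes>\<^bsub>F\<^esub> v)"
      using rF v by (metis K.m_closed q.H.inv_closed q.H.inv_equality q.H.inv_inv q.hom_closed)
    then show "(K_words #>\<^bsub>F\<^esub> r) \<otimes>\<^bsub>F Mod K_words\<^esub> (K_words #>\<^bsub>F\<^esub> v)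
        = (K_words #>\<^bsub>F\<^esub> v) \<otimes>\<^bsub>F Mod K_words\<^esub> (K_words #>\<^bsub>F\<^esub> r)"
      using q.hom_mult rF v by metis
  next
    fix v g assume "v \<in> carrier F" "g \<in> \<O>" "commutator F v (free_gen g) \<in> R"
    then have "commutator F v (free_gen g) \<in> K_words"
      unfolding K_words_def by (intro generate.incl) blast
    then show "K_words #>\<^bsub>F\<^esub> commutator F v (free_gen g) = \<one>\<^bsub>F Mod K_words\<^esub>"
      using K.r_coset_eq_one_iff K.subset by blast
  qed
  moreover have "w \<in> carrier F"
    using w(1) normal_closure_relators_subset by (auto simp: kernel_def)
  ultimately show ?thesis using K.r_coset_eq_one_iff by blast
qed

lemma hopf_H2_projection: "group_hom (F\<lparr>carrier := M\<rparr>) (hopf_H2 G \<O>) (\<lambda>w. Z #>\<^bsub>F\<^esub> w)"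
  using normal.r_coset_group_hom[OF hopf_denominator_normal] by (simp add: hopf_H2_def r_coset_def)

lemma carrier_hopf_H2: "carrier (hopf_H2 G \<O>) = (\<lambda>w. Z #>\<^bsub>F\<^esub> w) ` M"
  by (simp add: hopf_H2_def carrier_FactGroup r_coset_def)

lemma M_subset: "M \<subseteq> carrier F"
  by (auto simp: mem_relator_subgroup)

lemma hopf_denominator_subset_N: "Z \<subseteq> N"
  unfolding hopf_denominator_def mixed_commutator_subgroup_def
  using commutator_relator_in_N
  by (intro group.generate_subgroup_incl[OF group_free_group _ normal_imp_subgroup[OF normal_closure_relators_normal]]) blast

lemma K_words_class:
  assumes "w \<in> K_words"
  shows "w \<in> M \<and> Z #>\<^bsub>F\<^esub> w \<in> K_subgroup G \<O>"
proof -
  interpret F: group F by (rule group_free_group)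
  interpret p: group_hom "F\<lparr>carrier := M\<rparr>" "hopf_H2 G \<O>" "\<lambda>w. Z #>\<^bsub>F\<^esub> w"
    by (rule hopf_H2_projection)
  interpret M: subgroup M F by (rule group_hopf_numerator)
  have gens: "commutator F v (free_gen g) \<in> M"
    if "v \<in> carrier F" "g \<in> \<O>" "commutator F v (free_gen g) \<in> R" for v g
    using that commutator_in_derived by simp
  have K: "subgroup (K_subgroup G \<O>) (hopf_H2 G \<O>)"
    unfolding K_subgroup_def using gens p.hom_closed
    by (intro p.H.generate_is_subgroup) auto
  interpret K: subgroup "K_subgroup G \<O>" "hopf_H2 G \<O>" by (rule K)
  have gen: "k \<in> M \<and> Z #>\<^bsub>F\<^esub> k \<in> K_subgroup G \<O>"
    if "k \<in> {commutator F a r | a r. a \<in> carrier F \<and> r \<in> R} \<union>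
     {commutator F w (free_gen g) | w g. w \<in> carrier F \<and> g \<in> \<O> \<and> commutator F w (free_gen g) \<in> R}" for k
    using that
  proof (elim UnE CollectE exE conjE)
    fix a r assume k: "k = commutator F a r" "a \<in> carrier F" "r \<in> R"
    have "k \<in> M" using k commutator_relator by blast
    moreover have "k \<in> Z"
      unfolding hopf_denominator_def mixed_commutator_subgroup_def using k by (intro generate.incl) blast
    then have "Z #>\<^bsub>F\<^esub> k = \<one>\<^bsub>hopf_H2 G \<O>\<^esub>"
      using normal.r_coset_eq_one_iff[OF hopf_denominator_normal, of k] \<open>k \<in> M\<close>
      by (simp add: hopf_H2_def r_coset_def)
    ultimately show ?thesis using K.one_closed by simp
  next
    fix v g assume k: "k = commutator F v (free_gen g)" "v \<in> carrier F" "g \<in> \<O>"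
      "commutator F v (free_gen g) \<in> R"
    then show ?thesis
      unfolding K_subgroup_def using gens by (blast intro: generate.incl)
  qed
  show ?thesis
    using assms unfolding K_words_def
  proof (induction rule: generate.induct)
    case one
    then show ?case using M.one_closed K.one_closed p.hom_one by simp
  next
    case (incl k)
    then show ?case by (rule gen)
  next
    case (inv k)
    then have k: "k \<in> M" "Z #>\<^bsub>F\<^esub> k \<in> K_subgroup G \<O>" using gen by blast+
    have "Z #>\<^bsub>F\<^esub> (inv\<^bsub>F\<^esub> k) = inv\<^bsub>hopf_H2 G \<O>\<^esub> (Z #>\<^bsub>F\<^esub> k)"
      using p.hom_inv[of k] k(1) F.m_inv_consistent[OF group_hopf_numerator k(1)] by simp
    then show ?case using k M.m_inv_closed K.m_inv_closed by simp
  next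
    case (eng k l)
    then show ?case using M.m_closed K.m_closed p.hom_mult[of k l] by simp
  qed
qed

definition ambiguity_group :: "'a word set monoid"
  where "ambiguity_group = (cover_group G \<O>)\<lparr>carrier :=
    kernel (cover_group G \<O>) G (cover_hom G) \<inter>
    derived (cover_group G \<O>) (carrier (cover_group G \<O>))\<rparr>"

lemma carrier_ambiguity_group: "carrier ambiguity_group = (\<lambda>w. N #>\<^bsub>F\<^esub> w) ` M"
proof -
  interpret p: group_hom F "cover_group G \<O>" "\<lambda>w. N #>\<^bsub>F\<^esub> w" by (rule cover_projection)
  have surj: "carrier (cover_group G \<O>) = (\<lambda>w. N #>\<^bsub>F\<^esub> w) ` carrier F"
    by (simp add: cover_group_def presented_group_def carrier_FactGroup)
  have "derived (cover_group G \<O>) (carrier (cover_group G \<O>)) = (\<lambda>w. N #>\<^bsub>F\<^esub> w) ` derived F (carrier F)"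
    unfolding surj by (rule p.derived_img) simp
  moreover have "N #>\<^bsub>F\<^esub> w \<in> kernel (cover_group G \<O>) G (cover_hom G) \<longleftrightarrow> w \<in> R"
    if "w \<in> carrier F" for w
    using that cover_hom_coset[OF that] p.hom_closed[OF that]
    by (simp add: kernel_def mem_relator_subgroup)
  moreover have "derived F (carrier F) \<subseteq> carrier F"
    using p.G.derived_in_carrier by simp
  ultimately show ?thesis unfolding ambiguity_group_def by auto
qed

lemma comm_group_ambiguity_group: "comm_group ambiguity_group"
proof -
  interpret p: group_hom F "cover_group G \<O>" "\<lambda>w. N #>\<^bsub>F\<^esub> w" by (rule cover_projection)
  interpret c: group_hom "cover_group G \<O>" G "cover_hom G"
    using cover_hom_hom by unfold_locales
  have "subgroup (kernel (cover_group G \<O>) G (cover_hom G) \<inter>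
    derived (cover_group G \<O>) (carrier (cover_group G \<O>))) (cover_group G \<O>)"
    by (intro p.H.subgroups_Inter_pair c.subgroup_kernel p.H.derived_is_subgroup order_refl)
  then have "group ambiguity_group"
    unfolding ambiguity_group_def by (rule subgroup.subgroup_is_group) (rule p.H.is_group)
  then show ?thesis
  proof (rule group.group_comm_groupI)
    fix x y assume "x \<in> carrier ambiguity_group" "y \<in> carrier ambiguity_group"
    then obtain r w where "x = N #>\<^bsub>F\<^esub> r" "y = N #>\<^bsub>F\<^esub> w" "r \<in> M" "w \<in> M"
      unfolding carrier_ambiguity_group by blast
    then show "x \<otimes>\<^bsub>ambiguity_group\<^esub> y = y \<otimes>\<^bsub>ambiguity_group\<^esub> x"
      using cover_central[of r w] M_subset by (auto simp: ambiguity_group_def)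
  qed
qed

text \<open>The map from \<open>H\<^sub>2\<close> to the cover that is induced by the identity of \<open>F\<close>: the class of \<open>w\<close> modulo \<open>[F, R]\<close> is a
  subset of its class modulo \<open>N\<close>, and multiplication by \<open>N\<close> turns the former into the latter.\<close>

definition hopf_to_cover :: "'a word set \<Rightarrow> 'a word set"
  where "hopf_to_cover C = N <#>\<^bsub>F\<^esub> C"

lemma hopf_to_cover_class: "w \<in> M \<Longrightarrow> hopf_to_cover (Z #>\<^bsub>F\<^esub> w) = N #>\<^bsub>F\<^esub> w"
proof -
  assume w: "w \<in> M"
  interpret N: normal N F by (rule normal_closure_relators_normal)
  have "\<one>\<^bsub>F\<^esub> \<in> Z"
    unfolding hopf_denominator_def mixed_commutator_subgroup_def by (rule generate.one)
  have "N <#>\<^bsub>F\<^esub> Z = N"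
  proof
    show "N <#>\<^bsub>F\<^esub> Z \<subseteq> N" using hopf_denominator_subset_N by (auto simp: set_mult_def)
    show "N \<subseteq> N <#>\<^bsub>F\<^esub> Z"
    proof
      fix n assume "n \<in> N"
      then have "n = n \<otimes>\<^bsub>F\<^esub> \<one>\<^bsub>F\<^esub>" by simp
      then show "n \<in> N <#>\<^bsub>F\<^esub> Z" using \<open>n \<in> N\<close> \<open>\<one>\<^bsub>F\<^esub> \<in> Z\<close> unfolding set_mult_def by blast
    qed
  qed
  moreover have "N <#>\<^bsub>F\<^esub> (Z #>\<^bsub>F\<^esub> w) = (N <#>\<^bsub>F\<^esub> Z) #>\<^bsub>F\<^esub> w"
    using w M_subset N.subset hopf_denominator_subset_N by (intro N.setmult_rcos_assoc) auto
  ultimately show ?thesis by (simp add: hopf_to_cover_def)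
qed

lemma hopf_to_cover_hom: "group_hom (hopf_H2 G \<O>) ambiguity_group hopf_to_cover"
proof -
  interpret p: group_hom F "cover_group G \<O>" "\<lambda>w. N #>\<^bsub>F\<^esub> w" by (rule cover_projection)
  interpret h: group_hom "F\<lparr>carrier := M\<rparr>" "hopf_H2 G \<O>" "\<lambda>w. Z #>\<^bsub>F\<^esub> w"
    by (rule hopf_H2_projection)
  interpret M: subgroup M F by (rule group_hopf_numerator)
  have "hopf_to_cover \<in> hom (hopf_H2 G \<O>) ambiguity_group"
  proof (rule homI)
    show "hopf_to_cover C \<in> carrier ambiguity_group" if "C \<in> carrier (hopf_H2 G \<O>)" for C
      using that hopf_to_cover_class by (auto simp: carrier_hopf_H2 carrier_ambiguity_group)
    fix C D assume "C \<in> carrier (hopf_H2 G \<O>)" "D \<in> carrier (hopf_H2 G \<O>)"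
    then obtain v w where vw: "C = Z #>\<^bsub>F\<^esub> v" "D = Z #>\<^bsub>F\<^esub> w" "v \<in> M" "w \<in> M"
      unfolding carrier_hopf_H2 by blast
    have "C \<otimes>\<^bsub>hopf_H2 G \<O>\<^esub> D = Z #>\<^bsub>F\<^esub> (v \<otimes>\<^bsub>F\<^esub> w)"
      using h.hom_mult[of v w] vw by simp
    then have "hopf_to_cover (C \<otimes>\<^bsub>hopf_H2 G \<O>\<^esub> D) = N #>\<^bsub>F\<^esub> (v \<otimes>\<^bsub>F\<^esub> w)"
      using hopf_to_cover_class[OF M.m_closed[OF vw(3,4)]] by (simp only:)
    also have "\<dots> = (N #>\<^bsub>F\<^esub> v) \<otimes>\<^bsub>cover_group G \<O>\<^esub> (N #>\<^bsub>F\<^esub> w)"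
      by (rule p.hom_mult[OF M.mem_carrier[OF vw(3)] M.mem_carrier[OF vw(4)]])
    finally show "hopf_to_cover (C \<otimes>\<^bsub>hopf_H2 G \<O>\<^esub> D) = hopf_to_cover C \<otimes>\<^bsub>ambiguity_group\<^esub> hopf_to_cover D"
      using vw hopf_to_cover_class by (simp add: ambiguity_group_def)
  qed
  then show ?thesis
    using group_hopf_H2 comm_group_ambiguity_group
    by (simp add: group_hom_def group_hom_axioms_def comm_group_def)
qed

lemma hopf_to_cover_surj: "hopf_to_cover ` carrier (hopf_H2 G \<O>) = carrier ambiguity_group"
  unfolding carrier_hopf_H2 carrier_ambiguity_group image_image
  using hopf_to_cover_class by (intro image_cong) auto

text \<open>The class of \<open>w \<in> R \<inter> [F, F]\<close> is in the kernel iff \<open>w \<in> N\<close>, and such a \<open>w\<close> is in the preimage of \<open>K\<close> by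
  \<open>N_Int_derived\<close>.\<close>

lemma kernel_hopf_to_cover: "kernel (hopf_H2 G \<O>) ambiguity_group hopf_to_cover = K_subgroup G \<O>"
proof
  interpret h: group_hom "hopf_H2 G \<O>" ambiguity_group hopf_to_cover by (rule hopf_to_cover_hom)
  have ker: "Z #>\<^bsub>F\<^esub> w \<in> kernel (hopf_H2 G \<O>) ambiguity_group hopf_to_cover \<longleftrightarrow> w \<in> N" if "w \<in> M" for w
    using that hopf_to_cover_class[OF that] cover_projection_eq_one_iff[of w] M_subset
    by (auto simp: kernel_def carrier_hopf_H2 ambiguity_group_def)
  show "kernel (hopf_H2 G \<O>) ambiguity_group hopf_to_cover \<subseteq> K_subgroup G \<O>"
  proof
    fix C assume C: "C \<in> kernel (hopf_H2 G \<O>) ambiguity_group hopf_to_cover"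
    then obtain w where w: "C = Z #>\<^bsub>F\<^esub> w" "w \<in> M" by (auto simp: kernel_def carrier_hopf_H2)
    then have "w \<in> N" using C ker by blast
    then show "C \<in> K_subgroup G \<O>" using w N_Int_derived K_words_class by blast
  qed
  show "K_subgroup G \<O> \<subseteq> kernel (hopf_H2 G \<O>) ambiguity_group hopf_to_cover"
    unfolding K_subgroup_def
  proof (rule h.G.generate_subgroup_incl[OF _ h.subgroup_kernel], clarify)
    fix w g assume *: "w \<in> carrier F" "g \<in> \<O>" "commutator F w (free_gen g) \<in> R"
    then have "commutator F w (free_gen g) \<in> M" using commutator_in_derived by simp
    then show "Z #>\<^bsub>F\<^esub> commutator F w (free_gen g) \<in> kernel (hopf_H2 G \<O>) ambiguity_group hopf_to_cover"
      using ker commutator_gen_in_N * by blast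
  qed
qed

lemma ambiguity_index_eq_b_index: "ambiguity_index G \<O> = b_index G \<O>"
proof -
  interpret Q: comm_group ambiguity_group by (rule comm_group_ambiguity_group)
  have "group Q_mod_Z" using comm_group_Q_mod_Z by (simp add: comm_group_def)
  have "ambiguity_index G \<O> = card (carrier ambiguity_group)"
    by (simp add: ambiguity_index_def ambiguity_group_def)
  also have "\<dots> = card (hom ambiguity_group Q_mod_Z \<inter> extensional (carrier ambiguity_group))"
    by (rule Q.card_hom_Q_mod_Z[symmetric])
  also have "\<dots> = card (B_group G \<O>)"
    using bij_betw_same_card[OF bij_betw_hom_factor[OF hopf_to_cover_hom hopf_to_cover_surj \<open>group Q_mod_Z\<close>]]
    by (simp add: B_group_def kernel_hopf_to_cover)
  finally show ?thesis by (simp add: b_index_def)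
qed

end

theorem theorem10:
  fixes G :: "('a, 'b) monoid_scheme" and \<O> :: "'a set"
  assumes "equipped_finite_group G \<O>"
  shows "ambiguity_index G \<O> = b_index G \<O>"
  using assms by (rule equipped_finite_group.ambiguity_index_eq_b_index)

end
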